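(* Let $m\ge 1$ and $n=3m$. For every integer $t\ge 1$, the connectivity of $I(G_{n,t})$ and the connectivity of $I(H_{n,t})$ are both equal to $(2m-1)t-1$.
   Context: For a finite simple graph $G$, $I(G)$ is its independence complex (simplicial complex on $V(G)$ whose simplices are the independent sets). The connectivity of a space $X$ is the largest $k$ such that $X$ is $k$-connected (so the connectivity of $S^k$ is $k-1$). For integers $n\ge 2$, $t\ge 0$, the graph $G_{n,t}$ (the line graph of a row of $t$ $(2n)$-gons) has vertex set $\{a_0,\dots,a_t\}\cup\{b_{i,j},c_{i,j}: 1\le i\le t,\ 1\le j\le n-1\}$, and its edges are exactly: $b_{i,j}\sim b_{i,j+1}$ and $c_{i,j}\sim c_{i,j+1}$ for $1\le i\le t$, $1\le j\le n-2$; $b_{i,n-1}\sim b_{i+1,1}$ and $c_{i,n-1}\sim c_{i+1,1}$ for $1\le i\le t-1$; and $a_{i-1}\sim b_{i,1}$, $a_{i-1}\sim c_{i,1}$, $a_i\sim b_{i,n-1}$, $a_i\sim c_{i,n-1}$ for $1\le i\le t$. For $t\ge 0$, $H_{n,t}$ is the induced subgraph of $G_{n,t+1}$ on $V(G_{n,t})\cup\{b_{t+1,1},c_{t+1,1}\}$. *)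

theory Defs
  imports "HOL-Analysis.Analysis"
begin

datatype vtx = A nat | B nat nat | C nat nat

definition G_verts :: "nat \<Rightarrow> nat \<Rightarrow> vtx set" where
  "G_verts n t = {A i | i. i \<le> t}
     \<union> {B i j | i j. 1 \<le> i \<and> i \<le> t \<and> 1 \<le> j \<and> j \<le> n - 1}
     \<union> {C i j | i j. 1 \<le> i \<and> i \<le> t \<and> 1 \<le> j \<and> j \<le> n - 1}"

definition G_edge0 :: "nat \<Rightarrow> nat \<Rightarrow> vtx \<Rightarrow> vtx \<Rightarrow> bool" where
  "G_edge0 n t u v \<longleftrightarrow>
     (\<exists>i j. 1 \<le> i \<and> i \<le> t \<and> 1 \<le> j \<and> j \<le> n - 2 \<and>
        ((u = B i j \<and> v = B i (j+1)) \<or> (u = C i j \<and> v = C i (j+1))))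
   \<or> (\<exists>i. 1 \<le> i \<and> i \<le> t - 1 \<and>
        ((u = B i (n-1) \<and> v = B (i+1) 1) \<or> (u = C i (n-1) \<and> v = C (i+1) 1)))
   \<or> (\<exists>i. 1 \<le> i \<and> i \<le> t \<and>
        ((u = A (i-1) \<and> v = B i 1) \<or> (u = A (i-1) \<and> v = C i 1)
       \<or> (u = A i \<and> v = B i (n-1)) \<or> (u = A i \<and> v = C i (n-1))))"

definition G_adj :: "nat \<Rightarrow> nat \<Rightarrow> vtx \<Rightarrow> vtx \<Rightarrow> bool" where
  "G_adj n t u v \<longleftrightarrow> G_edge0 n t u v \<or> G_edge0 n t v u"

definition H_verts :: "nat \<Rightarrow> nat \<Rightarrow> vtx set" where
  "H_verts n t = G_verts n t \<union> {B (t+1) 1, C (t+1) 1}"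

definition H_adj :: "nat \<Rightarrow> nat \<Rightarrow> vtx \<Rightarrow> vtx \<Rightarrow> bool" where
  "H_adj n t u v \<longleftrightarrow> u \<in> H_verts n t \<and> v \<in> H_verts n t \<and> G_adj n (t+1) u v"

definition indep_complex :: "'v set \<Rightarrow> ('v \<Rightarrow> 'v \<Rightarrow> bool) \<Rightarrow> 'v set set" where
  "indep_complex V E = {S. S \<subseteq> V \<and> (\<forall>u\<in>S. \<forall>v\<in>S. \<not> E u v)}"

(* geometric realization of a (finite) simplicial complex K on vertex type 'v,
   as points with barycentric coordinates, topologized as a subspace of R^'v *)
definition geom_real :: "'v set set \<Rightarrow> ('v \<Rightarrow> real) topology" where
  "geom_real K = subtopology (powertop_real UNIV)
     {x. (\<forall>v. 0 \<le> x v) \<and> {v. x v \<noteq> 0} \<in> K \<and> finite {v. x v \<noteq> 0}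
         \<and> sum x {v. x v \<noteq> 0} = 1}"

(* X is k-connected (k \<ge> -1): nonempty, and every map S^i \<rightarrow> X, 0 \<le> i \<le> k,
   is homotopic to a constant map *)
definition k_connected :: "'a topology \<Rightarrow> int \<Rightarrow> bool" where
  "k_connected X k \<longleftrightarrow> topspace X \<noteq> {} \<and>
     (\<forall>i::nat. int i \<le> k \<longrightarrow>
        (\<forall>f. continuous_map (nsphere i) X f \<longrightarrow>
           (\<exists>c \<in> topspace X. homotopic_with (\<lambda>_. True) (nsphere i) X f (\<lambda>_. c))))"

definition connectivity_eq :: "'a topology \<Rightarrow> int \<Rightarrow> bool" where
  "connectivity_eq X c \<longleftrightarrow> k_connected X c \<and> \<not> k_connected X (c + 1)"

end

theory Submission
  imports Defs "HOL-Homology.Brouwer_Degree"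
begin

text \<open>Lower bound: if deleting \<open>v\<close> from a complex leaves a \<open>k\<close>-connected complex and the link of \<open>v\<close> is
  \<open>(k - 1)\<close>-connected, then the complex is \<open>k\<close>-connected. For independence complexes these are the
  complexes of \<open>G - v\<close> and \<open>G - N[v]\<close>; in particular removing the closed neighbourhood of the neighbour of a
  leaf costs one degree of connectivity. Splitting \<open>G\<^sub>n\<^sub>,\<^sub>t\<close> and \<open>H\<^sub>n\<^sub>,\<^sub>t\<close> at the last vertex \<open>a\<^sub>t\<close> and eating up the
  dangling paths three vertices at a time leads to the same graphs with smaller \<open>t\<close>.

  Upper bound: for \<open>n = 3m\<close> the vertices \<open>a\<^sub>i\<close>, \<open>b\<^sub>i\<^sub>,\<^sub>3\<^sub>k\<close>, \<open>c\<^sub>i\<^sub>,\<^sub>3\<^sub>k\<close> form a perfect code: their closed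
  neighbourhoods partition the vertex set. Choosing one further vertex in each of these \<open>(2m - 1)t + 1\<close> stars
  such that the chosen edges form an induced matching exhibits a sphere of dimension \<open>(2m - 1)t\<close> as a
  retract.\<close>

section \<open>Geometric realizations and contiguous maps\<close>

text \<open>Write n = 3r + 3, so that a block has two rows of 3r + 2 vertices. One more block has to
  gain 2r + 1 degrees: 2r of them come from cutting r triples off each row, the last one from the
  splitting at a rung or from one further leaf. On the other side a block contributes 2r + 1 stars,
  r per row and one for its rung, so the two bounds meet. Connectivity is tested by maps of spheres
  and not by homology, so deletion and link cannot simply be compared in an exact sequence: a given
  map has to be pushed off the vertex by hand. For this purpose spheres are boundaries of cubes,
  which subdivide into cells that are cubes again. On an i-sphere all cells have dimension at most
  i, and extending a map over such cells asks only for an (i - 1)-connected target. This is why the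
  link may be one degree worse than the deletion.\<close>

definition realiz :: "'v set set \<Rightarrow> ('v \<Rightarrow> real) set" where
  "realiz K = {x. (\<forall>v. 0 \<le> x v) \<and> {v. x v \<noteq> 0} \<in> K \<and> finite {v. x v \<noteq> 0} \<and> sum x {v. x v \<noteq> 0} = 1}"

lemma geom_real_eq: "geom_real K = top_of_set (realiz K)"
  by (simp add: geom_real_def realiz_def euclidean_product_topology)

lemma realizI:
  assumes "\<And>v. 0 \<le> x v" "{v. x v \<noteq> 0} \<in> K" "finite T" "{v. x v \<noteq> 0} \<subseteq> T" "sum x T = 1"
  shows "x \<in> realiz K"
proof -
  have "sum x {v. x v \<noteq> 0} = sum x T"
    using assms by (intro sum.mono_neutral_left) auto
  then show ?thesis using assms finite_subset by (auto simp: realiz_def)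
qed

lemma realizD:
  assumes "x \<in> realiz K"
  shows "0 \<le> x v" "{v. x v \<noteq> 0} \<in> K" "finite {v. x v \<noteq> 0}" 
  using assms by (auto simp: realiz_def)

lemma realiz_sum:
  assumes "x \<in> realiz K" "finite T" "{v. x v \<noteq> 0} \<subseteq> T"
  shows "sum x T = 1"
proof -
  have "sum x {v. x v \<noteq> 0} = sum x T"
    using assms by (intro sum.mono_neutral_left) auto
  then show ?thesis using assms by (auto simp: realiz_def)
qed

definition mix :: "real \<Rightarrow> ('v \<Rightarrow> real) \<Rightarrow> ('v \<Rightarrow> real) \<Rightarrow> 'v \<Rightarrow> real" where
  "mix s x y = (\<lambda>v. (1 - s) * x v + s * y v)"

lemma mix_in_realiz:
  assumes down: "\<And>\<sigma> \<tau>. \<sigma> \<in> K \<Longrightarrow> \<tau> \<subseteq> \<sigma> \<Longrightarrow> \<tau> \<in> K"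
    and x: "x \<in> realiz K1" and y: "y \<in> realiz K2" and s: "0 \<le> s" "s \<le> 1"
    and un: "{v. x v \<noteq> 0} \<union> {v. y v \<noteq> 0} \<in> K"
  shows "mix s x y \<in> realiz K"
proof (rule realizI)
  let ?T = "{v. x v \<noteq> 0} \<union> {v. y v \<noteq> 0}"
  show "0 \<le> mix s x y v" for v using s realizD(1)[OF x] realizD(1)[OF y] by (simp add: mix_def)
  show sub: "{v. mix s x y v \<noteq> 0} \<subseteq> ?T" by (auto simp: mix_def)
  show "{v. mix s x y v \<noteq> 0} \<in> K" using down[OF un sub] .
  show fin: "finite ?T" using realizD(3)[OF x] realizD(3)[OF y] by auto
  show "sum (mix s x y) ?T = 1"
    using realiz_sum[OF x fin] realiz_sum[OF y fin]
    by (simp add: mix_def sum.distrib flip: sum_distrib_left)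
qed

text \<open>The segment from \<open>f z\<close> to \<open>g z\<close> stays in the simplex spanned
  by the two supports, so the straight-line homotopy never leaves the realization.\<close>

lemma contiguous_homotopic:
  fixes f g :: "'z::topological_space \<Rightarrow> 'v \<Rightarrow> real"
  assumes down: "\<And>\<sigma> \<tau>. \<sigma> \<in> K \<Longrightarrow> \<tau> \<subseteq> \<sigma> \<Longrightarrow> \<tau> \<in> K"
    and f: "continuous_on Z f" "f ` Z \<subseteq> realiz K"
    and g: "continuous_on Z g" "g ` Z \<subseteq> realiz K"
    and un: "\<And>z. z \<in> Z \<Longrightarrow> {v. f z v \<noteq> 0} \<union> {v. g z v \<noteq> 0} \<in> K"
  shows "homotopic_with_canon (\<lambda>_. True) Z (realiz K) f g"
  unfolding homotopic_with_def 
proof (intro exI conjI)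
  let ?h = "\<lambda>p. mix (fst p) (f (snd p)) (g (snd p))"
  have c: "continuous_on ({0..1} \<times> Z) ?h"
  proof (rule continuous_on_coordinatewise_then_product)
    fix v
    have "continuous_on ({0..1} \<times> Z) (\<lambda>p. f (snd p) v)"
      by (rule continuous_on_compose2[OF continuous_on_product_then_coordinatewise[OF f(1)]]) (auto intro: continuous_intros)
    moreover have "continuous_on ({0..1} \<times> Z) (\<lambda>p. g (snd p) v)"
      by (rule continuous_on_compose2[OF continuous_on_product_then_coordinatewise[OF g(1)]]) (auto intro: continuous_intros)
    ultimately show "continuous_on ({0..1} \<times> Z) (\<lambda>p. ?h p v)"
      unfolding mix_def by (intro continuous_intros) 
  qed
  have im: "?h ` ({0..1} \<times> Z) \<subseteq> realiz K"
    using f(2) g(2) un by (auto intro!: mix_in_realiz[OF down])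
  show "continuous_map (prod_topology (top_of_set {0..1}) (top_of_set Z)) (top_of_set (realiz K)) ?h"
    using c im by (auto simp: prod_topology_subtopology_eu)
qed (auto simp: mix_def)

section \<open>Spheres as boundaries of cubes\<close>

definition linf :: "nat \<Rightarrow> (nat \<Rightarrow> real) \<Rightarrow> real" where
  "linf n x = Max ((\<lambda>j. \<bar>x j\<bar>) ` {..<n})"

definition l2 :: "nat \<Rightarrow> (nat \<Rightarrow> real) \<Rightarrow> real" where
  "l2 n x = sqrt (\<Sum>j<n. (x j)\<^sup>2)"

text \<open>Points keep infinitely many coordinates, zero from \<open>n\<close> on, to match the
  encoding of \<open>nsphere\<close>. Thus \<open>cube_bd (Suc i)\<close> is an i-sphere, and
  \<open>cube_bd 0\<close> is empty.\<close>

definition cube :: "nat \<Rightarrow> (nat \<Rightarrow> real) set" where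
  "cube n = {x. (\<forall>j\<ge>n. x j = 0) \<and> (\<forall>j<n. \<bar>x j\<bar> \<le> 1)}"

definition cube_bd :: "nat \<Rightarrow> (nat \<Rightarrow> real) set" where
  "cube_bd n = {x \<in> cube n. \<exists>j<n. \<bar>x j\<bar> = 1}"

lemma continuous_on_linf: 
  assumes "\<And>j. j < n \<Longrightarrow> continuous_on S (\<lambda>z. f z j)" "0 < n"
  shows "continuous_on S (\<lambda>z. linf n (f z))"
  using assms unfolding linf_def
proof (induction n)
  case (Suc n)
  show ?case
  proof (cases "n = 0")
    case True
    then show ?thesis using continuous_on_rabs[OF Suc.prems(1)[of 0]] by (simp add: lessThan_Suc)
  next
    case False
    have "(\<lambda>j. \<bar>f z j\<bar>) ` {..<Suc n} = insert \<bar>f z n\<bar> ((\<lambda>j. \<bar>f z j\<bar>) ` {..<n})" for z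
      by (auto simp: lessThan_Suc)
    then have "Max ((\<lambda>j. \<bar>f z j\<bar>) ` {..<Suc n}) = max \<bar>f z n\<bar> (Max ((\<lambda>j. \<bar>f z j\<bar>) ` {..<n}))" for z
      using False by (metis Max_insert finite_imageI finite_lessThan image_is_empty lessThan_empty_iff bot_nat_def)
    moreover have "continuous_on S (\<lambda>z. max \<bar>f z n\<bar> (Max ((\<lambda>j. \<bar>f z j\<bar>) ` {..<n})))"
      using Suc False by (intro continuous_on_max continuous_on_rabs) auto
    ultimately show ?thesis by simp
  qed
qed auto

lemma linf_ge: "j < n \<Longrightarrow> \<bar>x j\<bar> \<le> linf n x"
  unfolding linf_def by (intro Max_ge) auto

lemma linf_attained: "0 < n \<Longrightarrow> \<exists>j<n. linf n x = \<bar>x j\<bar>"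
proof -
  assume "0 < n"
  then have "Max ((\<lambda>j. \<bar>x j\<bar>) ` {..<n}) \<in> (\<lambda>j. \<bar>x j\<bar>) ` {..<n}" by (intro Max_in) auto
  then show ?thesis by (auto simp: linf_def)
qed

lemma linf_scale: 
  assumes "0 < n" "0 \<le> c" shows "linf n (\<lambda>j. c * x j) = c * linf n x"
proof -
  obtain i where i: "i < n" "linf n (\<lambda>j. c * x j) = \<bar>c * x i\<bar>" using linf_attained assms by blast
  obtain k where k: "k < n" "linf n x = \<bar>x k\<bar>" using linf_attained assms by blast
  have "\<bar>c * x k\<bar> \<le> \<bar>c * x i\<bar>" using linf_ge[OF k(1), of "\<lambda>j. c * x j"] i by simp
  moreover have "\<bar>c * x i\<bar> \<le> c * \<bar>x k\<bar>" using linf_ge[OF i(1), of x] k assms by (simp add: abs_mult mult_left_mono)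
  ultimately show ?thesis using i k assms by (simp add: abs_mult)
qed

lemma l2_scale: "0 \<le> c \<Longrightarrow> l2 n (\<lambda>j. c * x j) = c * l2 n x"
  by (simp add: l2_def power_mult_distrib real_sqrt_mult flip: sum_distrib_left)

lemma l2_pos_iff: "0 < l2 n x \<longleftrightarrow> (\<exists>j<n. x j \<noteq> 0)"
proof -
  have "l2 n x = 0 \<longleftrightarrow> (\<forall>j<n. x j = 0)"
    by (auto simp: l2_def sum_nonneg_eq_0_iff)
  moreover have "l2 n x \<ge> 0" by (simp add: l2_def sum_nonneg)
  ultimately show ?thesis by (metis less_le order_less_irrefl)
qed

lemma linf_pos_iff:
  assumes "0 < n" shows "0 < linf n x \<longleftrightarrow> (\<exists>j<n. x j \<noteq> 0)"
proof
  assume "0 < linf n x"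
  then show "\<exists>j<n. x j \<noteq> 0" using linf_attained[OF assms, of x] by force
next
  assume "\<exists>j<n. x j \<noteq> 0"
  then show "0 < linf n x" using linf_ge[of _ n x] by (smt (verit) zero_less_abs_iff)
qed

lemma topspace_nsphere: "topspace (nsphere i) = {x. l2 (Suc i) x = 1 \<and> (\<forall>j\<ge>Suc i. x j = 0)}"
  by (auto simp: nsphere l2_def lessThan_Suc_atMost Suc_le_eq)

lemma nsphere_top_of_set: "nsphere i = top_of_set (topspace (nsphere i))"
  by (simp add: nsphere euclidean_product_topology)

lemma cube_bd_linf: "0 < n \<Longrightarrow> cube_bd n = {x. linf n x = 1 \<and> (\<forall>j\<ge>n. x j = 0)}"
proof -
  assume n: "0 < n"
  have "linf n x = 1 \<longleftrightarrow> (\<forall>j<n. \<bar>x j\<bar> \<le> 1) \<and> (\<exists>j<n. \<bar>x j\<bar> = 1)" for x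
  proof
    assume "linf n x = 1"
    then show "(\<forall>j<n. \<bar>x j\<bar> \<le> 1) \<and> (\<exists>j<n. \<bar>x j\<bar> = 1)"
      using linf_attained[OF n, of x] linf_ge[of _ n x] by metis
  next
    assume "(\<forall>j<n. \<bar>x j\<bar> \<le> 1) \<and> (\<exists>j<n. \<bar>x j\<bar> = 1)"
    then show "linf n x = 1"
      using linf_attained[OF n, of x] linf_ge[of _ n x] by (metis order_antisym)
  qed
  then show ?thesis by (auto simp: cube_bd_def cube_def)
qed

text \<open>Radial projection: both norms are positively homogeneous, so normalising by one and then
  by the other restores the point.\<close>

lemma homeomorphism_cube_bd_sphere:
  "homeomorphism (cube_bd (Suc i)) (topspace (nsphere i))
     (\<lambda>x j. x j / l2 (Suc i) x) (\<lambda>y j. y j / linf (Suc i) y)"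
proof -
  let ?n = "Suc i"
  have c: "continuous_on S (\<lambda>x. x j)" for S :: "(nat \<Rightarrow> real) set" and j
    by (rule continuous_on_subset[OF continuous_on_product_coordinates]) simp
  have b: "0 < l2 ?n x" if "x \<in> cube_bd ?n" for x
  proof -
    have "0 < linf ?n x" using that by (simp add: cube_bd_linf)
    then show ?thesis by (simp only: l2_pos_iff linf_pos_iff zero_less_Suc)
  qed
  have s: "0 < linf ?n y" if "y \<in> topspace (nsphere i)" for y
  proof -
    have "0 < l2 ?n y" using that by (simp add: topspace_nsphere)
    then show ?thesis by (simp only: l2_pos_iff linf_pos_iff zero_less_Suc)
  qed
  have ls: "linf ?n (\<lambda>j. x j / a) = linf ?n x / a" "l2 ?n (\<lambda>j. x j / a) = l2 ?n x / a" if "0 < a" for x a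
    using linf_scale[of ?n "1/a" x] l2_scale[of "1/a" ?n x] that by auto
  show ?thesis
  proof (rule homeomorphismI)
    show "continuous_on (cube_bd ?n) (\<lambda>x j. x j / l2 ?n x)"
    proof (rule continuous_on_coordinatewise_then_product)
      fix j
      have "continuous_on (cube_bd ?n) (l2 ?n)"
        unfolding l2_def by (intro continuous_intros c)
      then show "continuous_on (cube_bd ?n) (\<lambda>x. x j / l2 ?n x)"
        by (rule continuous_on_divide[OF c]) (metis b less_irrefl)
    qed
    show "continuous_on (topspace (nsphere i)) (\<lambda>y j. y j / linf ?n y)"
    proof (rule continuous_on_coordinatewise_then_product)
      fix j
      have "continuous_on (topspace (nsphere i)) (\<lambda>y. linf ?n y)"
        by (intro continuous_on_linf c) simp
      then show "continuous_on (topspace (nsphere i)) (\<lambda>x. x j / linf ?n x)"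
        by (rule continuous_on_divide[OF c]) (metis s less_irrefl)
    qed
    show "(\<lambda>x j. x j / l2 ?n x) ` cube_bd ?n \<subseteq> topspace (nsphere i)"
    proof (rule image_subsetI)
      fix x assume x: "x \<in> cube_bd ?n"
      then have "l2 ?n x \<noteq> 0" using b by force
      with b[OF x] x show "(\<lambda>j. x j / l2 ?n x) \<in> topspace (nsphere i)"
        by (simp add: topspace_nsphere cube_bd_linf ls)
    qed
    show "(\<lambda>x j. x j / linf ?n x) ` topspace (nsphere i) \<subseteq> cube_bd ?n"
    proof (rule image_subsetI)
      fix x assume x: "x \<in> topspace (nsphere i)"
      then have "linf ?n x \<noteq> 0" using s by force
      with s[OF x] x show "(\<lambda>j. x j / linf ?n x) \<in> cube_bd ?n"
        by (simp add: topspace_nsphere cube_bd_linf ls)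
    qed
    show "(\<lambda>j. (x j / l2 ?n x) / linf ?n (\<lambda>j. x j / l2 ?n x)) = x" if x: "x \<in> cube_bd ?n" for x
    proof -
      have "l2 ?n x \<noteq> 0" using b x by force
      with b[OF x] x show ?thesis
        by (simp add: cube_bd_linf ls)
    qed
    show "(\<lambda>j. (x j / linf ?n x) / l2 ?n (\<lambda>j. x j / linf ?n x)) = x" if x: "x \<in> topspace (nsphere i)" for x
    proof -
      have "linf ?n x \<noteq> 0" using s x by force
      with s[OF x] x show ?thesis
        by (simp add: topspace_nsphere ls)
    qed
  qed
qed

lemma k_connected_mono: "k_connected X k \<Longrightarrow> l \<le> k \<Longrightarrow> k_connected X l"
  unfolding k_connected_def by (meson order_trans)

text \<open>Together with \<open>k_connected_cube_bdI\<close> this replaces the round test spheres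
  of \<open>k_connected\<close> by cube boundaries, which can be cut into small cubes.\<close>

lemma k_connected_cube_bdD:
  assumes Y: "k_connected (top_of_set Y) k" and i: "int i \<le> k"
    and f: "continuous_on (cube_bd (Suc i)) f" "f ` cube_bd (Suc i) \<subseteq> Y"
  obtains c where "c \<in> Y" "homotopic_with_canon (\<lambda>_. True) (cube_bd (Suc i)) Y f (\<lambda>_. c)"
proof -
  obtain r s where h: "homeomorphism (cube_bd (Suc i)) (topspace (nsphere i)) r s"
    using homeomorphism_cube_bd_sphere by blast
  have "continuous_on (topspace (nsphere i)) (f \<circ> s)" "(f \<circ> s) ` topspace (nsphere i) \<subseteq> Y"
    using h f continuous_on_compose[of "topspace (nsphere i)" s f]
    by (simp_all add: homeomorphism_def image_subset_iff) blast
  then have "continuous_map (nsphere i) (top_of_set Y) (f \<circ> s)"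
    by (subst nsphere_top_of_set) auto
  then obtain c where c: "c \<in> Y" 
    "homotopic_with (\<lambda>_. True) (nsphere i) (top_of_set Y) (f \<circ> s) (\<lambda>_. c)"
    using Y i unfolding k_connected_def by auto
  have "continuous_map (top_of_set (cube_bd (Suc i))) (nsphere i) r"
    using h by (subst nsphere_top_of_set) (auto simp: homeomorphism_def)
  from homotopic_with_compose_continuous_map_right[OF c(2) this, of "\<lambda>_. True"]
  have "homotopic_with_canon (\<lambda>_. True) (cube_bd (Suc i)) Y (f \<circ> s \<circ> r) ((\<lambda>_. c) \<circ> r)" by simp
  then have "homotopic_with_canon (\<lambda>_. True) (cube_bd (Suc i)) Y f (\<lambda>_. c)"
    by (rule homotopic_with_eq) (use h in \<open>auto simp: homeomorphism_def\<close>)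
  with c show thesis using that by blast
qed

lemma k_connected_cube_bdI:
  assumes "Y \<noteq> {}"
    and c: "\<And>i f. \<lbrakk>int i \<le> k; continuous_on (cube_bd (Suc i)) f; f ` cube_bd (Suc i) \<subseteq> Y\<rbrakk> \<Longrightarrow>
       \<exists>c\<in>Y. homotopic_with_canon (\<lambda>_. True) (cube_bd (Suc i)) Y f (\<lambda>_. c)"
  shows "k_connected (top_of_set Y) k"
  unfolding k_connected_def
proof (intro conjI allI impI)
  fix i f assume i: "int i \<le> k" and "continuous_map (nsphere i) (top_of_set Y) f"
  then have f: "continuous_on (topspace (nsphere i)) f" "f ` topspace (nsphere i) \<subseteq> Y"
    by (subst (asm) nsphere_top_of_set, force)+
  obtain r s where h: "homeomorphism (cube_bd (Suc i)) (topspace (nsphere i)) r s"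
    using homeomorphism_cube_bd_sphere by blast
  have "continuous_on (cube_bd (Suc i)) (f \<circ> r)" "(f \<circ> r) ` cube_bd (Suc i) \<subseteq> Y"
    using h f continuous_on_compose[of "cube_bd (Suc i)" r f]
    by (simp_all add: homeomorphism_def image_subset_iff) blast
  then obtain c where c': "c \<in> Y" 
    "homotopic_with_canon (\<lambda>_. True) (cube_bd (Suc i)) Y (f \<circ> r) (\<lambda>_. c)"
    using c i by blast
  have "continuous_map (nsphere i) (top_of_set (cube_bd (Suc i))) s"
    using h by (subst nsphere_top_of_set) (auto simp: homeomorphism_def)
  from homotopic_with_compose_continuous_map_right[OF c'(2) this, of "\<lambda>_. True"]
  have "homotopic_with (\<lambda>_. True) (nsphere i) (top_of_set Y) (f \<circ> r \<circ> s) ((\<lambda>_. c) \<circ> s)" by simp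
  then have "homotopic_with (\<lambda>_. True) (nsphere i) (top_of_set Y) f (\<lambda>_. c)"
    by (rule homotopic_with_eq) (use h in \<open>auto simp: homeomorphism_def\<close>)
  with c' show "\<exists>c\<in>topspace (top_of_set Y). homotopic_with (\<lambda>_. True) (nsphere i) (top_of_set Y) f (\<lambda>_. c)"
    by auto
qed (use assms in auto)

text \<open>A null-homotopy on the boundary fills the cube: it is run along the radii of an outer
  shell, and the inner cube goes to its end point. For \<open>n = 0\<close> the boundary is empty
  and a point of \<open>Y\<close> is all that is needed.\<close>

lemma extend_over_cube:
  assumes Y: "k_connected (top_of_set Y) (int n - 1)"
    and h: "continuous_on (cube_bd n) h" "h ` cube_bd n \<subseteq> Y"
  obtains h' where "continuous_on (cube n) h'" "h' ` cube n \<subseteq> Y" "\<And>x. x \<in> cube_bd n \<Longrightarrow> h' x = h x"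
proof (cases n)
  case 0
  obtain c where "c \<in> Y" using Y by (auto simp: k_connected_def)
  then show thesis using that[of "\<lambda>_. c"] 0 by (auto simp: cube_bd_def)
next
  case (Suc i)
  then have n: "0 < n" by simp
  obtain c where c: "c \<in> Y" "homotopic_with_canon (\<lambda>_. True) (cube_bd n) Y h (\<lambda>_. c)"
    using k_connected_cube_bdD[OF Y, of i h] h Suc by auto
  then obtain H where H: "continuous_on ({0..1::real} \<times> cube_bd n) H" "H ` ({0..1} \<times> cube_bd n) \<subseteq> Y"
    "\<And>x. H (0, x) = h x" "\<And>x. H (1, x) = c"
    unfolding homotopic_with_def by (auto simp: image_subset_iff_funcset)
  \<comment> \<open>The time parameter is 0 on the boundary and 1 where
    \<open>linf n x = 1/2\<close>, and there \<open>H\<close> is constantly \<open>c\<close>. The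
    direction of \<open>x\<close>, meaningless at the origin, is used outside the inner cube
    only.\<close>
  define h' where "h' = (\<lambda>x. if linf n x \<le> 1/2 then c else H (2 - 2 * linf n x, \<lambda>j. x j / linf n x))"
  have le: "linf n x \<le> 1" if "x \<in> cube n" for x
    using that linf_attained[OF n, of x] by (auto simp: cube_def)
  have bd: "(\<lambda>j. x j / linf n x) \<in> cube_bd n" if "x \<in> cube n" "1/2 \<le> linf n x" for x
  proof -
    have "linf n (\<lambda>j. x j / linf n x) = 1"
      using linf_scale[OF n, of "1 / linf n x" x] that by simp
    then show ?thesis using that by (simp add: cube_bd_linf[OF n]) (simp add: cube_def)
  qed
  have cl: "continuous_on S (linf n)" "continuous_on S (\<lambda>x. x j)" for S and j :: nat
    by (intro continuous_on_linf n continuous_on_subset[OF continuous_on_product_coordinates subset_UNIV])+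
  show thesis
  proof
    show "continuous_on (cube n) h'"
      unfolding h'_def
    proof (rule continuous_on_cases_le)
      show "continuous_on {t \<in> cube n. 1/2 \<le> linf n t} (\<lambda>x. H (2 - 2 * linf n x, \<lambda>j. x j / linf n x))"
      proof (rule continuous_on_compose2[OF H(1)])
        have "continuous_on {t \<in> cube n. 1/2 \<le> linf n t} (\<lambda>x j. x j / linf n x)"
          by (intro continuous_on_coordinatewise_then_product continuous_on_divide cl) auto
        then show "continuous_on {t \<in> cube n. 1/2 \<le> linf n t} (\<lambda>x. (2 - 2 * linf n x, \<lambda>j. x j / linf n x))"
          by (intro continuous_on_Pair continuous_on_diff continuous_on_mult continuous_on_const cl)
      qed (use bd le in auto)
      show "c = H (2 - 2 * linf n x, \<lambda>j. x j / linf n x)" if "linf n x = 1/2" for x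
      proof -
        have "2 - 2 * linf n x = 1" using that by simp
        then show ?thesis using H(4) by simp
      qed
    qed (auto intro: cl)
    have "H (2 - 2 * linf n x, \<lambda>j. x j / linf n x) \<in> Y" if "x \<in> cube n" "\<not> linf n x \<le> 1/2" for x
      using H(2) bd[of x] le[of x] that by (force simp: image_subset_iff)
    then show "h' ` cube n \<subseteq> Y" using c by (auto simp: h'_def)
    show "h' x = h x" if "x \<in> cube_bd n" for x
      using that H(3) by (simp add: h'_def cube_bd_linf[OF n])
  qed
qed

section \<open>Extending maps over grids of cells\<close>

text \<open>A cell of the grid of mesh \<open>1/N\<close> is given by its lower corner (in units of the mesh) and the set of
  directions in which it extends. Every point lies in the relative interior of exactly one cell, its
  minimal cell, so that a set of cells is a subcomplex if it contains the minimal cells of its points.\<close>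

definition cell :: "real \<Rightarrow> (nat \<Rightarrow> int) \<times> nat set \<Rightarrow> (nat \<Rightarrow> real) set" where
  "cell N c = {x. \<forall>j. if j \<in> snd c then of_int (fst c j) \<le> N * x j \<and> N * x j \<le> of_int (fst c j) + 1
                      else N * x j = of_int (fst c j)}"

text \<open>In a free direction, an integral coordinate of a point of the cell is one of the two end
  points, so this is the relative boundary.\<close>

definition cell_bd :: "real \<Rightarrow> (nat \<Rightarrow> int) \<times> nat set \<Rightarrow> (nat \<Rightarrow> real) set" where
  "cell_bd N c = {x \<in> cell N c. \<exists>j\<in>snd c. N * x j \<in> \<int>}"

definition min_cell :: "real \<Rightarrow> (nat \<Rightarrow> real) \<Rightarrow> (nat \<Rightarrow> int) \<times> nat set" where
  "min_cell N x = ((\<lambda>j. \<lfloor>N * x j\<rfloor>), {j. N * x j \<notin> \<int>})"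

lemma closed_cell: "closed (cell N c)"
proof -
  have "closed {x. if j \<in> snd c then of_int (fst c j) \<le> N * x j \<and> N * x j \<le> of_int (fst c j) + 1
                      else N * x j = of_int (fst c j)}" for j
    by (cases "j \<in> snd c")
       (auto intro!: closed_Collect_conj closed_Collect_le closed_Collect_eq continuous_on_mult 
          continuous_on_const continuous_on_product_coordinates)
  then show ?thesis unfolding cell_def by (rule closed_Collect_all)
qed

lemma mem_min_cell: "x \<in> cell N (min_cell N x)"
  by (auto simp: cell_def min_cell_def Ints_def)

lemma Ints_between: "of_int a \<le> (y::real) \<Longrightarrow> y \<le> of_int a + 1 \<Longrightarrow> y \<in> \<int> \<longleftrightarrow> y = of_int a \<or> y = of_int a + 1"
  by (smt (verit, best) Ints_cases Ints_of_int Ints_1 Ints_add of_int_1 of_int_add of_int_less_iff)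

lemma min_cell_cases:
  assumes "x \<in> cell N c"
  obtains "min_cell N x = c" | "x \<in> cell_bd N c"
proof (cases "x \<in> cell_bd N c")
  case False
  have "\<lfloor>N * x j\<rfloor> = fst c j \<and> (N * x j \<notin> \<int> \<longleftrightarrow> j \<in> snd c)" for j
  proof (cases "j \<in> snd c")
    case True
    then have "of_int (fst c j) \<le> N * x j" "N * x j \<le> of_int (fst c j) + 1" "N * x j \<notin> \<int>"
      using assms False by (auto simp: cell_def cell_bd_def split: if_splits)
    moreover have "N * x j \<noteq> of_int (fst c j) + 1" using calculation(3) by (metis Ints_of_int of_int_1 of_int_add)
    ultimately show ?thesis using True by (auto simp: floor_eq_iff)
  next
    case False
    then have "N * x j = of_int (fst c j)" using assms by (auto simp: cell_def split: if_splits)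
    then show ?thesis using False by simp
  qed
  then have "min_cell N x = c" by (auto simp: min_cell_def prod_eq_iff)
  then show thesis by (rule that)
qed

lemma min_cell_bd: "x \<in> cell_bd N c \<Longrightarrow> snd (min_cell N x) \<subset> snd c"
  by (auto simp: cell_bd_def cell_def min_cell_def split: if_splits)

lemma min_cell_subset:
  assumes "x \<in> cell N c" shows "cell N (min_cell N x) \<subseteq> cell N c"
proof
  fix y assume y: "y \<in> cell N (min_cell N x)"
  have "if j \<in> snd c then of_int (fst c j) \<le> N * y j \<and> N * y j \<le> of_int (fst c j) + 1
                      else N * y j = of_int (fst c j)" for j
  proof -
    have cx: "if j \<in> snd c then of_int (fst c j) \<le> N * x j \<and> N * x j \<le> of_int (fst c j) + 1
                      else N * x j = of_int (fst c j)"
      using assms by (simp add: cell_def)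
    have cy: "if N * x j \<notin> \<int> then of_int \<lfloor>N * x j\<rfloor> \<le> N * y j \<and> N * y j \<le> of_int \<lfloor>N * x j\<rfloor> + 1
                      else N * y j = of_int \<lfloor>N * x j\<rfloor>"
      using y[unfolded cell_def min_cell_def mem_Collect_eq, rule_format, of j] by (simp split: if_splits)
    show ?thesis
    proof (cases "N * x j \<in> \<int>")
      case True
      then have "N * y j = N * x j" using cy by (auto elim: Ints_cases)
      show ?thesis unfolding \<open>N * y j = N * x j\<close> by (rule cx)
    next
      case False
      then have j: "j \<in> snd c" using cx by (auto split: if_splits)
      then have b: "of_int (fst c j) \<le> N * x j" "N * x j \<le> of_int (fst c j) + 1" using cx by auto
      have "N * x j \<noteq> of_int (fst c j) + 1" using False by (metis Ints_of_int of_int_1 of_int_add)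
      then have "\<lfloor>N * x j\<rfloor> = fst c j" using b by (auto simp: floor_eq_iff)
      then show ?thesis using cy False j by simp
    qed
  qed
  then show "y \<in> cell N c" by (simp add: cell_def)
qed

text \<open>Affine rescaling of the free directions, enumerated by \<open>e\<close>, identifies the
  cell with a standard cube (\<open>p\<close> one way, \<open>q\<close> back) and boundary with
  boundary.\<close>

lemma extend_over_cell:
  fixes Y :: "'a::topological_space set"
  assumes N: "0 < N" and fin: "finite (snd c)"
    and Y: "k_connected (top_of_set Y) (int (card (snd c)) - 1)"
    and h: "continuous_on (cell_bd N c) h" "h ` cell_bd N c \<subseteq> Y"
  obtains h' where "continuous_on (cell N c) h'" "h' ` cell N c \<subseteq> Y" "\<And>x. x \<in> cell_bd N c \<Longrightarrow> h' x = h x"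
proof -
  define n where "n = card (snd c)"
  obtain e where e: "bij_betw e {..<n} (snd c)"
    using fin ex_bij_betw_nat_finite[OF fin] by (auto simp: n_def lessThan_atLeast0)
  define e' where "e' = the_inv_into {..<n} e"
  have ee: "e' (e i) = i" "e i \<in> snd c" if "i < n" for i
    using that e by (auto simp: e'_def bij_betw_def the_inv_into_f_f)
  have ee': "e (e' j) = j" "e' j < n" if "j \<in> snd c" for j
    using that e by (auto simp: e'_def bij_betw_def f_the_inv_into_f) 
      (metis (no_types, opaque_lifting) lessThan_iff bij_betw_def e bij_betw_apply bij_betw_the_inv_into)
  define p where "p x = (\<lambda>i. if i < n then 2 * (N * x (e i) - of_int (fst c (e i))) - 1 else 0)" for x
  define q where "q z = (\<lambda>j. (of_int (fst c j) + (if j \<in> snd c then (1 + z (e' j)) / 2 else 0)) / N)" for z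
  have cc: "continuous_on S (\<lambda>x. x j)" for S :: "(nat \<Rightarrow> real) set" and j :: nat
    by (rule continuous_on_subset[OF continuous_on_product_coordinates subset_UNIV])
  have cp: "continuous_on S p" for S
  proof (rule continuous_on_coordinatewise_then_product)
    show "continuous_on S (\<lambda>x. p x i)" for i
      by (cases "i < n") (auto simp: p_def intro!: continuous_on_mult continuous_on_diff continuous_on_const cc)
  qed
  have cq: "continuous_on S q" for S
  proof (rule continuous_on_coordinatewise_then_product)
    show "continuous_on S (\<lambda>x. q x i)" for i
      using N by (cases "i \<in> snd c") 
        (auto simp: q_def intro!: continuous_on_divide continuous_on_add continuous_on_const cc)
  qed
  have qp: "q (p x) = x" if "x \<in> cell N c" for x
  proof
    fix j show "q (p x) j = x j"
    proof (cases "j \<in> snd c")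
      case True
      then have "q (p x) j = (of_int (fst c j) + (1 + (2 * (N * x j - of_int (fst c j)) - 1)) / 2) / N"
        by (simp add: q_def p_def ee')
      also have "\<dots> = x j" using N by (simp add: field_simps)
      finally show ?thesis .
    next
      case False
      then have "N * x j = of_int (fst c j)" using that by (auto simp: cell_def split: if_splits)
      then show ?thesis using N False by (simp add: q_def field_simps)
    qed
  qed
  have p: "p x \<in> cube n" if "x \<in> cell N c" for x
  proof -
    have "of_int (fst c (e i)) \<le> N * x (e i) \<and> N * x (e i) \<le> of_int (fst c (e i)) + 1" if "i < n" for i
      using \<open>x \<in> cell N c\<close> ee(2)[OF that] by (auto simp: cell_def split: if_splits)
    then show ?thesis by (force simp: cube_def p_def)
  qed
  have q: "q z \<in> cell N c" if "z \<in> cube n" for z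
  proof -
    have "\<bar>z (e' j)\<bar> \<le> 1" if "j \<in> snd c" for j using \<open>z \<in> cube n\<close> ee'[OF that] by (simp add: cube_def)
    then show ?thesis using N by (auto simp: cell_def q_def abs_le_iff) (smt (verit))
  qed
  have pb: "p x \<in> cube_bd n" if xb: "x \<in> cell_bd N c" for x
  proof -
    have x: "x \<in> cell N c" using that by (simp add: cell_bd_def)
    obtain j where j: "j \<in> snd c" "N * x j \<in> \<int>" using xb by (auto simp: cell_bd_def)
    have "of_int (fst c j) \<le> N * x j" "N * x j \<le> of_int (fst c j) + 1"
      using x j by (auto simp: cell_def split: if_splits)
    then have "N * x j = of_int (fst c j) \<or> N * x j = of_int (fst c j) + 1" using Ints_between j by blast
    then have "\<bar>p x (e' j)\<bar> = 1" using ee'[OF j(1)] by (auto simp: p_def)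
    then show ?thesis using p[OF x] ee'[OF j(1)] by (auto simp: cube_bd_def)
  qed
  have qb: "q z \<in> cell_bd N c" if zb: "z \<in> cube_bd n" for z
  proof -
    have z: "z \<in> cube n" using that by (simp add: cube_bd_def)
    obtain i where i: "i < n" "\<bar>z i\<bar> = 1" using zb by (auto simp: cube_bd_def)
    have "N * q z (e i) = of_int (fst c (e i)) + (1 + z i) / 2" using N ee[OF i(1)] by (simp add: q_def)
    moreover have "(1 + z i) / 2 \<in> \<int>" using i(2) by (auto simp: abs_if split: if_splits)
    ultimately have "N * q z (e i) \<in> \<int>" by simp
    then show ?thesis using q[OF z] ee[OF i(1)] by (auto simp: cell_bd_def)
  qed
  have "continuous_on (cube_bd n) (h \<circ> q)" "(h \<circ> q) ` cube_bd n \<subseteq> Y"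
    using qb h continuous_on_compose2[OF h(1) cq, of "cube_bd n"] by (auto simp: o_def)
  then obtain h' where h': "continuous_on (cube n) h'" "h' ` cube n \<subseteq> Y" "\<And>x. x \<in> cube_bd n \<Longrightarrow> h' x = (h \<circ> q) x"
    using extend_over_cube[OF Y[folded n_def]] by blast
  show thesis
  proof
    show "continuous_on (cell N c) (h' \<circ> p)"
      using p continuous_on_compose2[OF h'(1) cp, of "cell N c"] by (auto simp: o_def)
    show "(h' \<circ> p) ` cell N c \<subseteq> Y" using p h'(2) by auto
    show "(h' \<circ> p) x = h x" if "x \<in> cell_bd N c" for x
      using pb[OF that] h'(3) qp[of x] that by (simp add: cell_bd_def)
  qed
qed

text \<open>The cells of \<open>F - F0\<close> are added one at a time, always one of least
  dimension, so that its boundary is covered already.\<close>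

lemma extend_over_cells:
  fixes Y :: "'a::topological_space set"
  assumes N: "0 < N" and "finite F" 
    and dim: "\<And>c. c \<in> F \<Longrightarrow> finite (snd c) \<and> card (snd c) \<le> d"
    and Y: "k_connected (top_of_set Y) (int d - 1)"
    and F: "\<And>c x. c \<in> F \<Longrightarrow> x \<in> cell N c \<Longrightarrow> min_cell N x \<in> F"
    and "F0 \<subseteq> F" "\<And>c x. c \<in> F0 \<Longrightarrow> x \<in> cell N c \<Longrightarrow> min_cell N x \<in> F0"
    and "continuous_on (\<Union>c\<in>F0. cell N c) h" "h ` (\<Union>c\<in>F0. cell N c) \<subseteq> Y"
  shows "\<exists>h'. continuous_on (\<Union>c\<in>F. cell N c) h' \<and> h' ` (\<Union>c\<in>F. cell N c) \<subseteq> Y \<and>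
           (\<forall>x\<in>\<Union>c\<in>F0. cell N c. h' x = h x)"
  using assms(6-)
proof (induction "card (F - F0)" arbitrary: F0 h)
  case 0
  then have "F0 = F" using \<open>finite F\<close> by auto
  then show ?case using 0 by blast
next
  case (Suc k)
  have ne: "F - F0 \<noteq> {}" using Suc.hyps(2) by (metis card.empty nat.distinct(1))
  define c where "c = arg_min_on (\<lambda>c. card (snd c)) (F - F0)"
  have c: "c \<in> F" "c \<notin> F0" using arg_min_if_finite(1)[OF _ ne] \<open>finite F\<close> by (auto simp: c_def)
  have cmin: "b \<in> F0" if "b \<in> F" "card (snd b) < card (snd c)" for b
    using arg_min_if_finite(2)[OF _ ne, of "\<lambda>c. card (snd c)"] \<open>finite F\<close> that by (auto simp: c_def)
  let ?U = "\<Union>c\<in>F0. cell N c"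
  have bd: "min_cell N x \<in> F0" if "x \<in> cell_bd N c" for x
  proof (rule cmin)
    show "min_cell N x \<in> F" using F c(1) that by (auto simp: cell_bd_def)
    show "card (snd (min_cell N x)) < card (snd c)"
      using psubset_card_mono min_cell_bd[OF that] dim[OF c(1)] by blast
  qed
  then have bdU: "cell_bd N c \<subseteq> ?U" using mem_min_cell by blast
  have Yc: "k_connected (top_of_set Y) (int (card (snd c)) - 1)"
    using k_connected_mono[OF Y] dim[OF c(1)] by simp
  obtain e where e: "continuous_on (cell N c) e" "e ` cell N c \<subseteq> Y" "\<And>x. x \<in> cell_bd N c \<Longrightarrow> e x = h x"
    using extend_over_cell[OF N _ Yc, of h] dim[OF c(1)] bdU Suc.prems(3,4)
    by (metis continuous_on_subset image_mono order_trans)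
  let ?h = "\<lambda>x. if x \<in> ?U then h x else e x"
  have UU: "(\<Union>c\<in>insert c F0. cell N c) = ?U \<union> cell N c" by auto
  have cont: "continuous_on (?U \<union> cell N c) ?h"
  proof (rule continuous_on_cases)
    show "closed ?U" using Suc.prems(1) \<open>finite F\<close> by (intro closed_UN) (auto simp: closed_cell intro: finite_subset)
    \<comment> \<open>A point of \<open>c\<close> that is covered already has its minimal cell in
      \<open>F0\<close>, hence different from \<open>c\<close>. So it lies on the boundary of
      \<open>c\<close>, where \<open>e\<close> agrees with \<open>h\<close>.\<close>
    show "\<forall>x. x \<in> ?U \<and> x \<notin> ?U \<or> x \<in> cell N c \<and> x \<in> ?U \<longrightarrow> h x = e x"
    proof (intro allI impI)
      fix x assume "x \<in> ?U \<and> x \<notin> ?U \<or> x \<in> cell N c \<and> x \<in> ?U"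
      then have x: "x \<in> cell N c" "x \<in> ?U" by auto
      then have "min_cell N x \<in> F0" using Suc.prems(2) by auto
      then have "min_cell N x \<noteq> c" using c by auto
      then show "h x = e x" using min_cell_cases[OF x(1)] e(3) by metis
    qed
  qed (use closed_cell e Suc.prems in auto)
  have "\<exists>h'. continuous_on (\<Union>c\<in>F. cell N c) h' \<and> h' ` (\<Union>c\<in>F. cell N c) \<subseteq> Y \<and>
           (\<forall>x\<in>\<Union>c\<in>insert c F0. cell N c. h' x = ?h x)"
  proof (rule Suc.hyps(1))
    have "F - insert c F0 = (F - F0) - {c}" by auto
    then show "k = card (F - insert c F0)" using Suc.hyps(2) c by simp
    show "insert c F0 \<subseteq> F" using c Suc.prems by auto
    show "min_cell N x \<in> insert c F0" if "b \<in> insert c F0" "x \<in> cell N b" for b x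
      using that Suc.prems(2) bd min_cell_cases by blast
    show "continuous_on (\<Union>c\<in>insert c F0. cell N c) ?h" using cont UU by simp
    show "?h ` (\<Union>c\<in>insert c F0. cell N c) \<subseteq> Y" unfolding UU image_subset_iff 
    proof
      fix x assume x: "x \<in> ?U \<union> cell N c"
      show "?h x \<in> Y"
      proof (cases "x \<in> ?U")
        case True
        then have "h x \<in> Y" using Suc.prems(4) by blast
        then show ?thesis using True by (simp only: if_True)
      next
        case False
        then show ?thesis using e(2) x by (simp only: image_subset_iff if_False) blast
      qed
    qed
  qed
  then show ?case by (metis (no_types, lifting) UU UnI1)
qed

section \<open>Connectivity from deletion and link\<close>

lemma compact_cube_bd: "compact (cube_bd n)"
proof -
  let ?P = "\<Pi>\<^sub>E j\<in>UNIV. if j < n then {-1..1::real} else {0}"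
  have "compact ?P"
    unfolding compactin_euclidean_iff[symmetric] euclidean_product_topology[symmetric] compactin_PiE
    by auto
  moreover have "closed (\<Union>j<n. {x::nat \<Rightarrow> real. \<bar>x j\<bar> = 1})"
    by (intro closed_UN ballI closed_Collect_eq continuous_on_rabs continuous_on_product_coordinates continuous_on_const) simp
  moreover have "cube_bd n = ?P \<inter> (\<Union>j<n. {x. \<bar>x j\<bar> = 1})"
    by (auto simp: cube_bd_def cube_def PiE_iff abs_le_iff split: if_splits)
  ultimately show ?thesis by (metis compact_Int_closed)
qed

text \<open>The metric on functions is a series of truncated coordinate distances with weights 1,
  1/2, 1/4, ..., which sum to 2.\<close>

lemma dist_fun_le:
  fixes x y :: "nat \<Rightarrow> real"
  assumes "\<And>j. \<bar>x j - y j\<bar> \<le> \<delta>"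
  shows "dist x y \<le> 2 * \<delta>"
proof -
  have d: "0 \<le> \<delta>" using assms[of 0] by linarith
  have le: "(1/2)^n * min (dist (x (from_nat n)) (y (from_nat n))) 1 \<le> (1/2)^n * \<delta>" for n
    using assms by (intro mult_left_mono) (auto simp: dist_real_def min.coboundedI1)
  have s: "summable (\<lambda>n. (1/2)^n * \<delta>)" by (intro summable_mult2 summable_geometric) simp
  have "dist x y \<le> suminf (\<lambda>n. (1/2)^n * \<delta>)"
    unfolding dist_fun_def
    by (rule suminf_le[OF le summable_comparison_test'[OF s] s]) (use le in auto)
  also have "\<dots> = 2 * \<delta>"
    by (subst suminf_mult2[symmetric]) (auto simp: suminf_geometric)
  finally show ?thesis .
qed

lemma cell_diff_le: 
  assumes "0 < N" "x \<in> cell N c" "y \<in> cell N c" shows "\<bar>x j - y j\<bar> \<le> 1 / N"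
proof -
  have "\<bar>N * x j - N * y j\<bar> \<le> 1"
    using assms(2,3)[unfolded cell_def mem_Collect_eq, rule_format, of j] by (auto split: if_splits)
  then have "N * \<bar>x j - y j\<bar> \<le> 1" using assms(1) by (simp add: abs_mult flip: right_diff_distrib)
  then show ?thesis using assms(1) by (simp add: field_simps)
qed

lemma fine_grid:
  fixes g :: "(nat \<Rightarrow> real) \<Rightarrow> real"
  assumes g: "continuous_on (cube_bd n) g" and "0 < \<epsilon>"
  obtains N :: nat where "0 < N"
    "\<And>c x y. \<lbrakk>cell N c \<subseteq> cube_bd n; x \<in> cell N c; y \<in> cell N c\<rbrakk> \<Longrightarrow> \<bar>g x - g y\<bar> < \<epsilon>"
proof -
  obtain \<delta> where d: "0 < \<delta>" "\<And>x y. \<lbrakk>x \<in> cube_bd n; y \<in> cube_bd n; dist y x < \<delta>\<rbrakk> \<Longrightarrow> dist (g y) (g x) < \<epsilon>"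
    using compact_uniformly_continuous[OF g compact_cube_bd] \<open>0 < \<epsilon>\<close> 
    unfolding uniformly_continuous_on_def by metis
  obtain N :: nat where N: "2 / \<delta> < N" using reals_Archimedean2 by blast
  have N0: "0 < real N" using N d(1) by (smt (verit) divide_pos_pos)
  show thesis
  proof
    show "0 < N" using N0 by simp
    fix c x y assume c: "cell N c \<subseteq> cube_bd n" and xy: "x \<in> cell N c" "y \<in> cell N c"
    have "dist x y \<le> 2 * (1 / N)" using cell_diff_le[OF N0 xy] by (rule dist_fun_le)
    also have "\<dots> < \<delta>" using N d(1) N0 by (simp add: field_simps)
    finally show "\<bar>g x - g y\<bar> < \<epsilon>" using d(2)[of y x] c xy by (auto simp: dist_real_def)
  qed
qed

text \<open>The bounds come from testing three points of the cell: \<open>z 0\<close> is its lower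
  corner, \<open>z (1/2)\<close> its centre, \<open>z 1\<close> its upper corner. The strict bound
  on the dimension is the decisive one.\<close>

lemma cell_in_cube_bd:
  assumes N: "0 < (N::nat)" and c: "cell N c \<subseteq> cube_bd n"
  shows "snd c \<subseteq> {..<n}" "card (snd c) < n" "\<And>j. j < n \<Longrightarrow> \<bar>fst c j\<bar> \<le> int N" "\<And>j. n \<le> j \<Longrightarrow> fst c j = 0"
proof -
  define z where "z = (\<lambda>s j. (of_int (fst c j) + (if j \<in> snd c then s else 0)) / N)"
  have z: "z s \<in> cube_bd n" if "0 \<le> s" "s \<le> 1" for s :: real
  proof -
    have "z s \<in> cell N c" using that N by (auto simp: z_def cell_def)
    then show ?thesis using c by auto
  qed
  show f0: "fst c j = 0" if "n \<le> j" for j 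
    using z[of 0] that N by (auto simp: cube_bd_def cube_def z_def)
  show sub: "snd c \<subseteq> {..<n}"
  proof
    fix j assume j: "j \<in> snd c"
    have "z 1 j \<noteq> 0" if "n \<le> j" using j f0[OF that] N by (simp add: z_def)
    then show "j \<in> {..<n}" using z[of 1] by (auto simp: cube_bd_def cube_def not_less[symmetric])
  qed
  show "\<bar>fst c j\<bar> \<le> int N" if "j < n" for j
  proof -
    have "\<bar>z 0 j\<bar> \<le> 1" using z[of 0] that by (auto simp: cube_bd_def cube_def)
    then have "\<bar>real_of_int (fst c j)\<bar> \<le> real N" using N by (simp add: z_def field_simps)
    then show ?thesis by linarith
  qed
  \<comment> \<open>At the centre the free coordinates are half-integers in units of the mesh, so a
    coordinate of absolute value 1 must belong to a fixed direction.\<close>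
  obtain j where j: "j < n" "\<bar>z (1/2) j\<bar> = 1" using z[of "1/2"] by (auto simp: cube_bd_def)
  have "j \<notin> snd c"
  proof
    assume "j \<in> snd c"
    then have "\<bar>of_int (fst c j) + 1/2\<bar> = real N" using j N by (simp add: z_def field_simps)
    then have "\<bar>of_int (2 * fst c j + 1)\<bar> = real_of_int (2 * int N)" by simp
    then have "\<bar>2 * fst c j + 1\<bar> = 2 * int N" by linarith
    then show False by presburger
  qed
  then have "snd c \<subset> {..<n}" using sub j by auto
  then show "card (snd c) < n" using psubset_card_mono[of "{..<n}"] by simp
qed

lemma finite_cells: 
  assumes N: "0 < (N::nat)" shows "finite {c. cell N c \<subseteq> cube_bd n}"
proof (rule finite_subset)
  let ?A = "{a::nat \<Rightarrow> int. \<forall>j. (j \<in> {..<n} \<longrightarrow> a j \<in> {- int N..int N}) \<and> (j \<notin> {..<n} \<longrightarrow> a j = 0)}"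
  show "{c. cell N c \<subseteq> cube_bd n} \<subseteq> ?A \<times> Pow {..<n}"
  proof
    fix c assume "c \<in> {c. cell N c \<subseteq> cube_bd n}"
    then have c: "cell N c \<subseteq> cube_bd n" by simp
    have "fst c \<in> ?A" using cell_in_cube_bd(3,4)[OF N c] by (auto simp: abs_le_iff) (smt (verit))
    then show "c \<in> ?A \<times> Pow {..<n}" using cell_in_cube_bd(1)[OF N c] by (auto simp: mem_Times_iff)
  qed
  show "finite (?A \<times> Pow {..<n})" by (intro finite_cartesian_product finite_set_of_finite_funs) auto
qed

text \<open>As \<open>N\<close> is an integer, a coordinate of absolute value 1 is a grid value and
  stays fixed on the minimal cell, while the others stay between neighbouring grid values and cannot
  pass 1 or -1.\<close>

lemma min_cell_cube_bd:
  assumes N: "0 < (N::nat)" and x: "x \<in> cube_bd n"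
  shows "cell N (min_cell N x) \<subseteq> cube_bd n"
proof
  fix y assume "y \<in> cell N (min_cell N x)"
  then have y: "if N * x j \<notin> \<int> then of_int \<lfloor>N * x j\<rfloor> \<le> N * y j \<and> N * y j \<le> of_int \<lfloor>N * x j\<rfloor> + 1
                      else N * y j = of_int \<lfloor>N * x j\<rfloor>" for j
    unfolding cell_def min_cell_def mem_Collect_eq fst_conv snd_conv by blast
  have eq: "y j = x j" if "N * x j \<in> \<int>" for j
    using y[of j] that N by (auto elim: Ints_cases)
  have "y j = 0" if "n \<le> j" for j using x that eq[of j] by (auto simp: cube_bd_def cube_def)
  moreover have "\<bar>y j\<bar> \<le> 1" if "j < n" for j
  proof (cases "N * x j \<in> \<int>")
    case True
    then show ?thesis using eq x that by (auto simp: cube_bd_def cube_def)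
  next
    case False
    have "\<bar>x j\<bar> \<le> 1" using x that by (auto simp: cube_bd_def cube_def)
    then have "N * \<bar>x j\<bar> \<le> real N * 1" by (intro mult_left_mono) auto
    then have "\<bar>N * x j\<bar> \<le> N" by (simp add: abs_mult)
    moreover have "N * x j \<noteq> N" using False by (metis Ints_of_nat)
    ultimately have "- int N \<le> \<lfloor>N * x j\<rfloor>" "\<lfloor>N * x j\<rfloor> + 1 \<le> int N" by linarith+
    then have "- real N \<le> of_int \<lfloor>N * x j\<rfloor>" "of_int \<lfloor>N * x j\<rfloor> + 1 \<le> real N" by linarith+
    then have "\<bar>N * y j\<bar> \<le> N" using y[of j] False by auto
    then show ?thesis using N by (simp add: abs_mult)
  qed
  moreover obtain j where j: "j < n" "\<bar>x j\<bar> = 1" using x by (auto simp: cube_bd_def)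
  have "N * x j \<in> \<int>" using j(2) by (auto simp: abs_if split: if_splits)
  then have "\<bar>y j\<bar> = 1" using eq j by simp
  ultimately show "y \<in> cube_bd n" using j(1) by (auto simp: cube_bd_def cube_def)
qed

section \<open>Pushing a map off a vertex\<close>

lemma mix_0: "mix 0 x y = x" and mix_1: "mix 1 x y = y"
  by (auto simp: mix_def)

lemma continuous_on_mix:
  assumes "continuous_on S s" "continuous_on S f" "continuous_on S g"
  shows "continuous_on S (\<lambda>x. mix (s x) (f x) (g x))"
  unfolding mix_def
  by (intro continuous_on_coordinatewise_then_product continuous_on_add continuous_on_mult continuous_on_diff
      continuous_on_const continuous_on_product_then_coordinatewise[OF assms(2)] 
      continuous_on_product_then_coordinatewise[OF assms(3)] assms(1))

lemma realiz_mono: "K \<subseteq> L \<Longrightarrow> realiz K \<subseteq> realiz L"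
  by (auto simp: realiz_def)

text \<open>Let \<open>g\<close> be the \<open>v\<close>-coordinate of a map \<open>f\<close> from the cube boundary. Pushing away from \<open>v\<close> (the map \<open>p\<close>) is
  only continuous where \<open>g < 1\<close>. On a fine grid it is used on the cells with \<open>g < 2/3\<close>; the remaining ones
  lie in the subcomplex of cells with \<open>g > 1/3\<close>, over which it is extended as a map into the link. The
  resulting map \<open>f1\<close> into the deletion is homotopic to \<open>f\<close>, because both become contiguous after being pulled
  into \<open>v\<close> by the cut-off \<open>\<phi>\<close>, which is 1 where the two maps are unrelated and 0 outside the star.\<close>

lemma k_connected_star_deletion:
  assumes down: "\<And>\<sigma> \<tau>. \<sigma> \<in> K \<Longrightarrow> \<tau> \<subseteq> \<sigma> \<Longrightarrow> \<tau> \<in> K"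
    and del: "k_connected (top_of_set (realiz {\<sigma> \<in> K. v \<notin> \<sigma>})) k"
    and link: "k_connected (top_of_set (realiz {\<sigma>. v \<notin> \<sigma> \<and> insert v \<sigma> \<in> K})) (k - 1)"
  shows "k_connected (top_of_set (realiz K)) k"
proof -
  let ?D = "realiz {\<sigma> \<in> K. v \<notin> \<sigma>}" and ?L = "realiz {\<sigma>. v \<notin> \<sigma> \<and> insert v \<sigma> \<in> K}"
  have LD: "?L \<subseteq> ?D" by (intro realiz_mono) (use down in auto)
  have DK: "?D \<subseteq> realiz K" by (intro realiz_mono) auto
  \<comment> \<open>\<open>k_connected\<close> includes nonemptiness in every degree, so the link
    has a point.\<close>
  have vK: "{v} \<in> K"
  proof -
    obtain y where "y \<in> ?L" using link by (auto simp: k_connected_def)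
    then have "insert v {u. y u \<noteq> 0} \<in> K" by (simp add: realiz_def)
    then show ?thesis using down by auto
  qed
  define V where "V = (\<lambda>u. if u = v then 1 else 0 :: real)"
  have suppV: "{u. V u \<noteq> 0} = {v}" by (auto simp: V_def)
  have VK: "V \<in> realiz K" by (rule realizI[where T = "{v}"]) (use vK suppV in \<open>auto simp: V_def\<close>)
  show ?thesis
  proof (rule k_connected_cube_bdI)
    show "realiz K \<noteq> {}" using VK by auto
    fix i f assume i: "int i \<le> k" and f: "continuous_on (cube_bd (Suc i)) f" "f ` cube_bd (Suc i) \<subseteq> realiz K"
    define n where "n = Suc i"
    let ?B = "cube_bd n"
    define g where "g x = f x v" for x
    have cf: "continuous_on ?B (\<lambda>x. f x u)" for u
      unfolding n_def by (rule continuous_on_product_then_coordinatewise[OF f(1)])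
    have fK: "f x \<in> realiz K" if "x \<in> ?B" for x using f(2) that by (auto simp: n_def)
    have cg: "continuous_on ?B g" unfolding g_def by (rule cf)
    \<comment> \<open>With oscillation below 1/9, \<open>g\<close> is at most 1/3 + 1/9 = 4/9
      outside the cells of \<open>F\<close> and at least 2/3 - 1/9 = 5/9 outside those of
      \<open>G\<close>. Hence the two families cover everything, and the cut-off \<phi> rises from 0
      to 1 between these two values.\<close>
    obtain N :: nat where N: "0 < N"
      and var: "\<And>c x y. \<lbrakk>cell N c \<subseteq> ?B; x \<in> cell N c; y \<in> cell N c\<rbrakk> \<Longrightarrow> \<bar>g x - g y\<bar> < 1/9"
      using fine_grid[OF cg, of "1/9"] by auto
    define F where "F = {c. cell N c \<subseteq> ?B \<and> (\<forall>x\<in>cell N c. 1/3 < g x)}"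
    define G where "G = {c. cell N c \<subseteq> ?B \<and> (\<forall>x\<in>cell N c. g x < 2/3)}"
    have fin: "finite F" "finite G" using finite_cells[OF N, of n] by (auto simp: F_def G_def intro: finite_subset)
    have clF: "min_cell N x \<in> F" if "c \<in> F" "x \<in> cell N c" for c x
      using min_cell_subset[OF that(2)] that(1) by (auto simp: F_def)
    have clG: "min_cell N x \<in> G" if "c \<in> G" "x \<in> cell N c" for c x
      using min_cell_subset[OF that(2)] that(1) by (auto simp: G_def)
    let ?UF = "\<Union>c\<in>F. cell N c" and ?UG = "\<Union>c\<in>G. cell N c" and ?UFG = "\<Union>c\<in>F \<inter> G. cell N c"
    have UFG: "?UF \<inter> ?UG = ?UFG"
    proof
      show "?UF \<inter> ?UG \<subseteq> ?UFG"
      proof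
        fix x assume "x \<in> ?UF \<inter> ?UG"
        then have "min_cell N x \<in> F \<inter> G" using clF clG by auto
        then show "x \<in> ?UFG" using mem_min_cell by (rule UN_I)
      qed
    qed auto
    have notF: "g x \<le> 4/9" if "x \<in> ?B" "x \<notin> ?UF" for x
    proof -
      have mc: "cell N (min_cell N x) \<subseteq> ?B" by (rule min_cell_cube_bd[OF N that(1)])
      have "min_cell N x \<notin> F" using that(2) mem_min_cell[of x N] by (metis UN_I)
      then obtain y where y: "y \<in> cell N (min_cell N x)" "g y \<le> 1/3" using mc by (auto simp: F_def not_less)
      have "\<bar>g x - g y\<bar> < 1/9" using var[OF mc mem_min_cell y(1)] .
      then show ?thesis using y(2) unfolding abs_less_iff by linarith
    qed
    have notG: "5/9 \<le> g x" if "x \<in> ?B" "x \<notin> ?UG" for x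
    proof -
      have mc: "cell N (min_cell N x) \<subseteq> ?B" by (rule min_cell_cube_bd[OF N that(1)])
      have "min_cell N x \<notin> G" using that(2) mem_min_cell[of x N] by (metis UN_I)
      then obtain y where y: "y \<in> cell N (min_cell N x)" "2/3 \<le> g y" using mc by (auto simp: G_def not_less)
      have "\<bar>g x - g y\<bar> < 1/9" using var[OF mc mem_min_cell y(1)] .
      then show ?thesis using y(2) unfolding abs_less_iff by linarith
    qed
    have cover: "?UF \<union> ?UG = ?B"
    proof
      show "?B \<subseteq> ?UF \<union> ?UG"
      proof
        fix x assume "x \<in> ?B"
        then show "x \<in> ?UF \<union> ?UG" using notF[of x] notG[of x] by (cases "x \<in> ?UF"; cases "x \<in> ?UG") auto
      qed
    qed (auto simp: F_def G_def)
    define p where "p x = (\<lambda>u. if u = v then 0 else f x u / (1 - g x))" for x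
    have psupp: "{u. p x u \<noteq> 0} = {u. f x u \<noteq> 0} - {v}" if "g x < 1" for x
      using that by (auto simp: p_def)
    have psum: "p x \<in> realiz M" if "x \<in> ?B" "g x < 1" "{u. f x u \<noteq> 0} - {v} \<in> M" for x M
    proof (rule realizI)
      let ?T = "{u. f x u \<noteq> 0} - {v}"
      show "0 \<le> p x u" for u using that(2) realizD(1)[OF fK[OF that(1)]] by (simp add: p_def)
      show "{u. p x u \<noteq> 0} \<in> M" using that psupp by simp
      show finT: "finite ?T" using realizD(3)[OF fK[OF that(1)]] by simp
      show "{u. p x u \<noteq> 0} \<subseteq> ?T" using psupp that by simp
      have "sum (f x) (insert v ?T) = 1" 
        by (rule realiz_sum[OF fK[OF that(1)]]) (use finT in auto)
      moreover have "sum (f x) (insert v ?T) = f x v + sum (f x) ?T" by (rule sum.insert) (use finT in auto)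
      ultimately have "sum (f x) ?T = 1 - g x" by (simp only: g_def)
      moreover have "sum (p x) ?T = sum (f x) ?T / (1 - g x)"
        unfolding sum_divide_distrib by (intro sum.cong) (auto simp: p_def)
      ultimately show "sum (p x) ?T = 1" using that(2) by simp
    qed
    have cp: "continuous_on ?UG p"
    proof (rule continuous_on_coordinatewise_then_product)
      have GB: "?UG \<subseteq> ?B" by (auto simp: G_def)
      show "continuous_on ?UG (\<lambda>x. p x u)" for u
      proof (cases "u = v")
        case False
        have "continuous_on ?UG (\<lambda>x. f x u / (1 - g x))"
          by (intro continuous_on_divide continuous_on_diff continuous_on_const 
                continuous_on_subset[OF cf GB] continuous_on_subset[OF cg GB]) (force simp: G_def)
        then show ?thesis using False by (simp add: p_def)
      qed (simp add: p_def)
    qed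
    \<comment> \<open>On the cells of \<open>F\<close> the vertex \<open>v\<close> has positive
      weight, so the rest of the support of \<open>f x\<close> is a simplex of the link.\<close>
    have pL: "p x \<in> ?L" if "x \<in> ?UFG" for x
    proof (rule psum)
      show x: "x \<in> ?B" "g x < 1" using that by (force simp: F_def G_def)+
      have "0 < g x" using that by (force simp: F_def)
      then have "insert v ({u. f x u \<noteq> 0} - {v}) = {u. f x u \<noteq> 0}" by (auto simp: g_def)
      then show "{u. f x u \<noteq> 0} - {v} \<in> {\<sigma>. v \<notin> \<sigma> \<and> insert v \<sigma> \<in> K}"
        using realizD(2)[OF fK[OF x(1)]] by auto
    qed
    have pD: "p x \<in> ?D" if "x \<in> ?UG" for x
    proof (rule psum)
      show x: "x \<in> ?B" "g x < 1" using that by (force simp: G_def)+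
      show "{u. f x u \<noteq> 0} - {v} \<in> {\<sigma> \<in> K. v \<notin> \<sigma>}"
        using down[OF realizD(2)[OF fK[OF x(1)]]] by auto
    qed
    have dim: "finite (snd c) \<and> card (snd c) \<le> i" if "c \<in> F" for c
      using cell_in_cube_bd(1,2)[OF N, of c n] that finite_subset by (auto simp: F_def n_def)
    have Lc: "k_connected (top_of_set ?L) (int i - 1)" using k_connected_mono[OF link] i by simp
    have "\<exists>e. continuous_on ?UF e \<and> e ` ?UF \<subseteq> ?L \<and> (\<forall>x\<in>?UFG. e x = p x)"
    proof (rule extend_over_cells[OF _ fin(1) dim Lc clF])
      show "continuous_on ?UFG p" by (rule continuous_on_subset[OF cp]) auto
      show "min_cell N x \<in> F \<inter> G" if "c \<in> F \<inter> G" "x \<in> cell N c" for c x using clF clG that by blast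
    qed (use N pL in auto)
    then obtain e where e: "continuous_on ?UF e" "e ` ?UF \<subseteq> ?L" "\<And>x. x \<in> ?UFG \<Longrightarrow> e x = p x" by blast
    define f1 where "f1 x = (if x \<in> ?UF then e x else p x)" for x
    have f1p: "f1 x = p x" if "x \<in> ?UG" for x 
    proof (cases "x \<in> ?UF")
      case True
      then have "x \<in> ?UFG" using UFG that by (metis IntI)
      then show ?thesis using True by (simp only: f1_def if_True e(3))
    qed (simp only: f1_def if_False)
    have f1L: "f1 x \<in> ?L" if "x \<in> ?UF" for x using that e(2) by (simp only: f1_def if_True image_subset_iff)
    have f1D: "f1 x \<in> ?D" if "x \<in> ?B" for x
    proof (cases "x \<in> ?UF")
      case False
      then have "x \<in> ?UG" using that unfolding cover[symmetric] by (simp only: Un_iff simp_thms)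
      then show ?thesis using f1p pD by (simp only:)
    next
      case True
      then show ?thesis by (rule subsetD[OF LD f1L])
    qed
    have f1c: "continuous_on ?B f1"
      unfolding cover[symmetric] f1_def
    proof (rule continuous_on_cases)
      show "closed ?UF" "closed ?UG" using fin by (auto intro!: closed_UN closed_cell)
      show "\<forall>x. x \<in> ?UF \<and> x \<notin> ?UF \<or> x \<in> ?UG \<and> x \<in> ?UF \<longrightarrow> e x = p x"
        using e(3) UFG by (metis IntI)
    qed (rule e cp)+
    obtain c where c: "c \<in> ?D" "homotopic_with_canon (\<lambda>_. True) ?B ?D f1 (\<lambda>_. c)"
    proof (rule k_connected_cube_bdD[OF del i])
      show "continuous_on (cube_bd (Suc i)) f1" using f1c by (simp only: n_def)
      show "f1 ` cube_bd (Suc i) \<subseteq> ?D" using f1D by (intro image_subsetI) (simp only: n_def)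
    qed (use that in \<open>simp only: n_def\<close>)
    have cK: "c \<in> realiz K" using c DK by auto
    have h4: "homotopic_with_canon (\<lambda>_. True) ?B (realiz K) f1 (\<lambda>_. c)"
      by (rule homotopic_with_subset_right[OF c(2) DK])
    define \<phi> where "\<phi> x = max 0 (min 1 (9 * g x - 4))" for x
    have \<phi>: "0 \<le> \<phi> x" "\<phi> x \<le> 1" for x by (auto simp: \<phi>_def)
    have \<phi>F: "x \<in> ?UF" if "x \<in> ?B" "\<phi> x \<noteq> 0" for x 
    proof (rule ccontr)
      assume "x \<notin> ?UF"
      then have "g x \<le> 4/9" by (rule notF[OF that(1)])
      then show False using that(2) by (simp add: \<phi>_def)
    qed
    have \<phi>g: "g x > 0" if "\<phi> x \<noteq> 0" for x using that by (auto simp: \<phi>_def split: if_splits)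
    have \<phi>G: "x \<in> ?UG" if "x \<in> ?B" "\<phi> x \<noteq> 1" for x 
    proof (rule ccontr)
      assume "x \<notin> ?UG"
      then have "5/9 \<le> g x" by (rule notG[OF that(1)])
      then show False using that(2) by (simp add: \<phi>_def)
    qed
    have c\<phi>: "continuous_on ?B \<phi>"
      unfolding \<phi>_def by (intro continuous_on_max continuous_on_min continuous_on_diff continuous_on_mult continuous_on_const cg)
    define f' where "f' x = mix (\<phi> x) (f x) V" for x
    define f1' where "f1' x = mix (\<phi> x) (f1 x) V" for x
    have c': "continuous_on ?B f'" "continuous_on ?B f1'"
      unfolding f'_def f1'_def by (intro continuous_on_mix c\<phi> f1c continuous_on_const f(1)[folded n_def])+
    have uf: "{u. f x u \<noteq> 0} \<union> {v} \<in> K" if "x \<in> ?B" "\<phi> x \<noteq> 0" for x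
    proof -
      have "{u. f x u \<noteq> 0} \<union> {v} = {u. f x u \<noteq> 0}" using \<phi>g[OF that(2)] by (auto simp: g_def)
      then show ?thesis using realizD(2)[OF fK[OF that(1)]] by simp
    qed
    have uf1: "{u. f1 x u \<noteq> 0} \<union> {v} \<in> K" if "x \<in> ?B" "\<phi> x \<noteq> 0" for x
      using f1L[OF \<phi>F[OF that]] by (simp add: realiz_def)
    have f'K: "f' x \<in> realiz K" if "x \<in> ?B" for x
    proof (cases "\<phi> x = 0")
      case False
      show ?thesis unfolding f'_def
        by (rule mix_in_realiz[OF down fK[OF that] VK]) (use \<phi> uf[OF that False] suppV in auto)
    qed (use fK[OF that] in \<open>simp add: f'_def mix_0\<close>)
    have f1K: "f1 x \<in> realiz K" if "x \<in> ?B" for x by (rule subsetD[OF DK f1D[OF that]])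
    have f1'K: "f1' x \<in> realiz K" if "x \<in> ?B" for x
    proof (cases "\<phi> x = 0")
      case False
      show ?thesis unfolding f1'_def
        by (rule mix_in_realiz[OF down f1K[OF that] VK]) (use \<phi> uf1[OF that False] suppV in auto)
    qed (use f1K[OF that] in \<open>simp add: f1'_def mix_0\<close>)
    have sup: "{u. mix s y V u \<noteq> 0} \<subseteq> {u. y u \<noteq> 0} \<union> {v}" for s y by (auto simp: mix_def V_def)
    have h1: "homotopic_with_canon (\<lambda>_. True) ?B (realiz K) f f'"
    proof (rule contiguous_homotopic[OF down])
      show "{u. f x u \<noteq> 0} \<union> {u. f' x u \<noteq> 0} \<in> K" if "x \<in> ?B" for x
      proof (cases "\<phi> x = 0")
        case True
        then show ?thesis using realizD(2)[OF fK[OF that]] by (simp add: f'_def mix_0)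
      next
        case False
        show ?thesis by (rule down[OF uf[OF that False]]) (use sup f'_def in auto)
      qed
    qed (use f[folded n_def] c' f'K in auto)
    have h3: "homotopic_with_canon (\<lambda>_. True) ?B (realiz K) f1 f1'"
    proof (rule contiguous_homotopic[OF down])
      show "{u. f1 x u \<noteq> 0} \<union> {u. f1' x u \<noteq> 0} \<in> K" if "x \<in> ?B" for x
      proof (cases "\<phi> x = 0")
        case True
        then show ?thesis using realizD(2)[OF f1K[OF that]] by (simp add: f1'_def mix_0)
      next
        case False
        show ?thesis by (rule down[OF uf1[OF that False]]) (use sup f1'_def in auto)
      qed
    qed (use f1c f1K c' f1'K in auto)
    \<comment> \<open>Where \<phi> is 1, both maps sit at \<open>v\<close>. Elsewhere the point lies
      in a cell of \<open>G\<close>, where \<open>f1\<close> is \<open>p\<close> and has its support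
      inside that of \<open>f\<close>; if moreover \<phi> is nonzero, that support contains
      \<open>v\<close> as well.\<close>
    have h2: "homotopic_with_canon (\<lambda>_. True) ?B (realiz K) f' f1'"
    proof (rule contiguous_homotopic[OF down])
      show "{u. f' x u \<noteq> 0} \<union> {u. f1' x u \<noteq> 0} \<in> K" if "x \<in> ?B" for x
      proof (cases "\<phi> x = 1")
        case True
        then show ?thesis using vK suppV by (simp add: f'_def f1'_def mix_1)
      next
        case False
        then have G: "x \<in> ?UG" using \<phi>G that by blast
        then have "g x < 1" by (force simp: G_def)
        then have s1: "{u. f1 x u \<noteq> 0} \<subseteq> {u. f x u \<noteq> 0}" using f1p[OF G] psupp by auto
        show ?thesis
        proof (cases "\<phi> x = 0")
          case True
          show ?thesis by (rule down[OF realizD(2)[OF fK[OF that]]]) (use s1 True in \<open>auto simp: f'_def f1'_def mix_0\<close>)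
        next
          case False
          show ?thesis by (rule down[OF uf[OF that False]]) (use sup[of "\<phi> x" "f x"] sup[of "\<phi> x" "f1 x"] s1 f'_def f1'_def in auto)
        qed
      qed
    qed (use c' f'K f1'K in auto)
    have "homotopic_with_canon (\<lambda>_. True) ?B (realiz K) f (\<lambda>_. c)"
      using homotopic_with_trans[OF h1 homotopic_with_trans[OF h2 homotopic_with_trans[OF homotopic_with_symD[OF h3] h4]]] .
    with cK show "\<exists>c\<in>realiz K. homotopic_with_canon (\<lambda>_. True) (cube_bd (Suc i)) (realiz K) f (\<lambda>_. c)"
      unfolding n_def by (intro bexI[where x = c])
  qed
qed

section \<open>Independence complexes\<close>

abbreviation indep_connected :: "'v set \<Rightarrow> ('v \<Rightarrow> 'v \<Rightarrow> bool) \<Rightarrow> int \<Rightarrow> bool" where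
  "indep_connected V E k \<equiv> k_connected (geom_real (indep_complex V E)) k"

lemma indep_complex_down: "\<sigma> \<in> indep_complex V E \<Longrightarrow> \<tau> \<subseteq> \<sigma> \<Longrightarrow> \<tau> \<in> indep_complex V E"
  by (auto simp: indep_complex_def)

lemma indep_complex_cong:
  "(\<And>u v. u \<in> V \<Longrightarrow> v \<in> V \<Longrightarrow> E u v = E' u v) \<Longrightarrow> indep_complex V E = indep_complex V E'"
  by (auto simp: indep_complex_def subset_iff)

lemma indep_connected_split:
  assumes sym: "\<And>u w. E u w \<Longrightarrow> E w u" and v: "v \<in> V" "\<not> E v v"
    and "indep_connected (V - {v}) E k" "indep_connected {u \<in> V. u \<noteq> v \<and> \<not> E v u} E (k - 1)"
  shows "indep_connected V E k"
proof -
  have "{\<sigma> \<in> indep_complex V E. v \<notin> \<sigma>} = indep_complex (V - {v}) E"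
    by (auto simp: indep_complex_def)
  moreover have "{\<sigma>. v \<notin> \<sigma> \<and> insert v \<sigma> \<in> indep_complex V E} = indep_complex {u \<in> V. u \<noteq> v \<and> \<not> E v u} E"
    using v sym by (auto simp: indep_complex_def)
  ultimately show ?thesis
    using assms k_connected_star_deletion[of "indep_complex V E" v k, OF indep_complex_down]
    by (simp add: geom_real_eq)
qed

lemma vertex_realiz: "v \<in> V \<Longrightarrow> \<not> E v v \<Longrightarrow> (\<lambda>u. if u = v then 1 else 0) \<in> realiz (indep_complex V E)"
  by (rule realizI[where T = "{v}"]) (auto simp: indep_complex_def)

text \<open>The complex is a cone with apex \<open>v\<close>, so every map is contiguous to the
  constant map at \<open>v\<close>.\<close>

lemma indep_connected_isolated:
  assumes v: "v \<in> V" "\<And>u. u \<in> V \<Longrightarrow> \<not> E u v \<and> \<not> E v u"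
  shows "indep_connected V E k"
  unfolding geom_real_eq
proof (rule k_connected_cube_bdI)
  let ?c = "\<lambda>u. if u = v then 1 else 0 :: real"
  have c: "?c \<in> realiz (indep_complex V E)" using vertex_realiz v by metis
  then show "realiz (indep_complex V E) \<noteq> {}" by blast
  fix i f assume f: "continuous_on (cube_bd (Suc i)) f" "f ` cube_bd (Suc i) \<subseteq> realiz (indep_complex V E)"
  have "homotopic_with_canon (\<lambda>_. True) (cube_bd (Suc i)) (realiz (indep_complex V E)) f (\<lambda>_. ?c)"
  proof (rule contiguous_homotopic[OF indep_complex_down])
    fix z assume "z \<in> cube_bd (Suc i)"
    then have "{u. f z u \<noteq> 0} \<in> indep_complex V E" using f(2) realizD(2) by blast
    moreover have "{u. ?c u \<noteq> 0} = {v}" by auto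
    ultimately show "{u. f z u \<noteq> 0} \<union> {u. ?c u \<noteq> 0} \<in> indep_complex V E"
      using v by (auto simp: indep_complex_def subset_iff)
  qed (use c f in auto)
  with c show "\<exists>c\<in>realiz (indep_complex V E).
      homotopic_with_canon (\<lambda>_. True) (cube_bd (Suc i)) (realiz (indep_complex V E)) f (\<lambda>_. c)"
    by (intro bexI[where x = ?c])
qed

text \<open>Deleting \<open>y\<close> isolates \<open>x\<close> and leaves a cone, so only the link
  of \<open>y\<close> limits the connectivity.\<close>

lemma indep_connected_leaf:
  assumes sym: "\<And>u w. E u w \<Longrightarrow> E w u" and xy: "x \<in> V" "y \<in> V" "x \<noteq> y" "\<not> E y y"
    and leaf: "\<And>w. w \<in> V \<Longrightarrow> w \<noteq> y \<Longrightarrow> \<not> E x w"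
    and k: "indep_connected {u \<in> V. u \<noteq> y \<and> \<not> E y u} E k"
  shows "indep_connected V E (k + 1)"
proof (rule indep_connected_split[where v = y])
  show "indep_connected (V - {y}) E (k + 1)"
    by (rule indep_connected_isolated[of x]) (use assms in auto)
qed (use assms in simp_all)

lemma indep_connected_minus_1:
  assumes "v \<in> V" "\<not> E v v"
  shows "indep_connected V E (-1)"
  using vertex_realiz[of v V E] assms by (auto simp: k_connected_def geom_real_eq)

text \<open>The rungs \<open>a i\<close> join two infinite paths \<open>b\<close>, \<open>c\<close>, numbered from 0 without regard to the division
  into blocks of length \<open>M\<close>.\<close>

locale ladder =
  fixes E :: "'v \<Rightarrow> 'v \<Rightarrow> bool" and a b c :: "nat \<Rightarrow> 'v" and M :: nat
  assumes sym: "E u v \<Longrightarrow> E v u"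
    and inj [simp]: "a i = a j \<longleftrightarrow> i = j" "b i = b j \<longleftrightarrow> i = j" "c i = c j \<longleftrightarrow> i = j"
    and distinct [simp]: "a i \<noteq> b j" "b i \<noteq> c j" "a i \<noteq> c j"
    and adj [simp]: "\<not> E (a i) (a j)" "\<not> E (b i) (c j)"
      "E (b i) (b j) \<longleftrightarrow> j = Suc i \<or> i = Suc j" "E (c i) (c j) \<longleftrightarrow> j = Suc i \<or> i = Suc j"
      "E (a i) (b j) \<longleftrightarrow> j = i * M \<or> Suc j = i * M" "E (a i) (c j) \<longleftrightarrow> j = i * M \<or> Suc j = i * M"
begin

lemma sym_iff: "E u v \<longleftrightarrow> E v u" using sym by blast

lemma distinct' [simp]: "b j \<noteq> a i" "c j \<noteq> b i" "c j \<noteq> a i"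
  using distinct by metis+

lemma adj' [simp]: "\<not> E (c j) (b i)" 
  "E (b j) (a i) \<longleftrightarrow> j = i * M \<or> Suc j = i * M" "E (c j) (a i) \<longleftrightarrow> j = i * M \<or> Suc j = i * M"
  using adj sym_iff by metis+

text \<open>All graphs of the recursion have this shape. For \<open>M = n - 1\<close> the graphs of
  the theorem are \<open>W (t + 1) (t * M) (t * M)\<close> and
  \<open>W (t + 1) (t * M + 1) (t * M + 1)\<close>.\<close>

definition W :: "nat \<Rightarrow> nat \<Rightarrow> nat \<Rightarrow> 'v set" where
  "W s p q = a ` {..<s} \<union> b ` {..<p} \<union> c ` {..<q}"

text \<open>Rung \<open>i\<close> meets the row at position \<open>i * M\<close> and just before it.
  By the first assumption no rung touches the last two vertices, so \<open>b (p + 2)\<close> is a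
  leaf, and the closed neighbourhood of \<open>b (p + 1)\<close> consists of exactly the last three
  vertices.\<close>

lemma tail_b:
  assumes s: "\<And>i. i < s \<Longrightarrow> i * M \<le> p" and k: "indep_connected (W s p q) E k"
  shows "indep_connected (W s (p + 3) q) E (k + 1)"
proof (rule indep_connected_leaf[where x = "b (p + 2)" and y = "b (p + 1)"])
  show "\<not> E (b (p + 2)) w" if "w \<in> W s (p + 3) q" "w \<noteq> b (p + 1)" for w
    using that s by (fastforce simp: W_def)
  have "{u \<in> W s (p + 3) q. u \<noteq> b (p + 1) \<and> \<not> E (b (p + 1)) u} = W s p q"
    using s by (fastforce simp: W_def)
  then show "indep_connected {u \<in> W s (p + 3) q. u \<noteq> b (p + 1) \<and> \<not> E (b (p + 1)) u} E k"
    using k by simp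
qed (auto simp: W_def sym)

end

lemma (in ladder) swap: "ladder E a c b M"
  by unfold_locales (auto simp: sym)

context ladder
begin

lemma tail_c:
  assumes "\<And>i. i < s \<Longrightarrow> i * M \<le> q" "indep_connected (W s p q) E k"
  shows "indep_connected (W s p (q + 3)) E (k + 1)"
proof -
  interpret s: ladder E a c b M by (rule swap)
  have "s.W s q p = W s p q" for s p q by (auto simp: s.W_def W_def)
  then show ?thesis using s.tail_b[of s q p k] assms by simp
qed

lemma tails:
  assumes "\<And>i. i < s \<Longrightarrow> i * M \<le> p" "\<And>i. i < s \<Longrightarrow> i * M \<le> q" "indep_connected (W s p q) E k"
  shows "indep_connected (W s (p + 3 * j) (q + 3 * j)) E (k + 2 * int j)"
proof (induction j)
  case (Suc j)
  have "indep_connected (W s (p + 3 * j + 3) (q + 3 * j + 3)) E (k + 2 * int j + 1 + 1)"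
    by (intro tail_b tail_c Suc) (use assms in \<open>fastforce intro: order_trans\<close>)+
  then show ?case by (simp add: algebra_simps)
qed (use assms in simp)

lemma indep_connected_end:
  assumes M: "2 \<le> M"
    and 0: "indep_connected (W (t + 1) p p) E k"
    and 1: "indep_connected (W (t + 1) ((t + 1) * M - 1) ((t + 1) * M - 1)) E (k - 1)"
    and p: "p = (t + 1) * M \<or> p = (t + 1) * M + 1"
  shows "indep_connected (W (t + 2) p p) E k"
proof (rule indep_connected_split[where v = "a (t + 1)"])
  have M0: "0 < (t + 1) * M" using M by simp
  have "W (t + 2) p p - {a (t + 1)} = W (t + 1) p p"
    by (auto simp: W_def less_Suc_eq)
  then show "indep_connected (W (t + 2) p p - {a (t + 1)}) E k" using 0 by simp
  have "{u \<in> W (t + 2) p p. u \<noteq> a (t + 1) \<and> \<not> E (a (t + 1)) u} = W (t + 1) ((t + 1) * M - 1) ((t + 1) * M - 1)"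
    using p M0 unfolding W_def by (fastforce simp: less_Suc_eq)
  then show "indep_connected {u \<in> W (t + 2) p p. u \<noteq> a (t + 1) \<and> \<not> E (a (t + 1)) u} E (k - 1)"
    using 1 by simp
qed (auto simp: W_def sym)

text \<open>Two vertices of each row stick out past the start of rung \<open>t\<close>, too few for
  \<open>tail_b\<close>. The neighbour \<open>b (t * M)\<close> of the leaf is adjacent to this
  rung, so its closed neighbourhood removes the rung as well. For \<open>t > 0\<close> the row
  \<open>c\<close> is then longer by exactly three, as \<open>tail_c\<close> wants it.\<close>

lemma indep_connected_fold:
  assumes M: "2 \<le> M" and k: "indep_connected (W t (t * M - 1) (t * M + 2)) E k"
  shows "indep_connected (W (t + 1) (t * M + 2) (t * M + 2)) E (k + 1)"
proof (rule indep_connected_leaf[where x = "b (t * M + 1)" and y = "b (t * M)"])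
  have le: "i * M \<le> t * M" if "i < t + 1" for i using that by simp
  have neq: "t * M \<noteq> i * M" if "i < t" for i using that M by simp
  show "\<not> E (b (t * M + 1)) w" if "w \<in> W (t + 1) (t * M + 2) (t * M + 2)" "w \<noteq> b (t * M)" for w
  proof -
    have "Suc (t * M) \<noteq> i * M \<and> Suc (Suc (t * M)) \<noteq> i * M" if "i < Suc t" for i
    proof -
      have "i * M \<le> t * M" by (rule le) (use that in simp)
      then show ?thesis by (intro conjI) linarith+
    qed
    then show ?thesis using that by (auto simp: W_def)
  qed
  have "{u \<in> W (t + 1) (t * M + 2) (t * M + 2). u \<noteq> b (t * M) \<and> \<not> E (b (t * M)) u} = W t (t * M - 1) (t * M + 2)"
    using le neq unfolding W_def by (fastforce simp: less_Suc_eq)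
  then show "indep_connected {u \<in> W (t + 1) (t * M + 2) (t * M + 2). u \<noteq> b (t * M) \<and> \<not> E (b (t * M)) u} E k"
    using k by simp
qed (auto simp: W_def sym)

text \<open>Neither half can be proved alone. Let \<open>s = t - 1\<close> and split at the last
  rung. The link is, for both graphs, the second graph for \<open>s\<close> with rows longer by 3r
  (\<open>Q\<close>). The deletion from the second graph is the first graph for \<open>s\<close>
  with rows longer by 3(r + 1). The deletion from the first graph leaves an overhang of 3r + 2,
  which is cut down to 2 and folded (\<open>F\<close>).\<close>

lemma ladder_connected:
  assumes M: "M = 3 * r + 2"
  shows "indep_connected (W (t + 1) (t * M) (t * M)) E ((2 * int r + 1) * int t - 1)
       \<and> indep_connected (W (t + 1) (t * M + 1) (t * M + 1)) E ((2 * int r + 1) * int t - 1)"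
proof (induction t rule: less_induct)
  case (less t)
  have M2: "2 \<le> M" using M by simp
  have mono: "i * M \<le> s * M" if "i < s + 1" for i s using that by simp
  have mono': "i * M \<le> s * M + x" if "i < s + 1" for i s x using mono[OF that] by (rule trans_le_add1)
  have Q: "indep_connected (W (s + 1) ((s + 1) * M - 1) ((s + 1) * M - 1)) E ((2 * int r + 1) * int (s + 1) - 2)"
    if "s < t" for s
  proof -
    have "indep_connected (W (s + 1) (s * M + 1 + 3 * r) (s * M + 1 + 3 * r)) E ((2 * int r + 1) * int s - 1 + 2 * int r)"
      by (rule tails[OF mono' mono']) (use less[OF that] in auto)
    moreover have "s * M + 1 + 3 * r = (s + 1) * M - 1" using M by simp
    ultimately show ?thesis by (simp add: algebra_simps)
  qed
  have F: "indep_connected (W (s + 1) (s * M + 2) (s * M + 2)) E ((2 * int r + 1) * int s)" if "s < t" for s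
  proof -
    have "indep_connected (W s (s * M - 1) (s * M + 2)) E ((2 * int r + 1) * int s - 1)"
    proof (cases s)
      \<comment> \<open>Truncated subtraction leaves only \<open>c 0\<close> and \<open>c 1\<close>
        here, and nonemptiness is enough. The equation \<open>s * M - 1 + 3 = s * M + 2\<close> of
        the other case fails for \<open>s = 0\<close>.\<close>
      case 0
      then show ?thesis using indep_connected_minus_1[of "c 0"] by (simp add: W_def)
    next
      case (Suc s')
      have "indep_connected (W s (s * M - 1) (s * M - 1 + 3)) E ((2 * int r + 1) * int s - 2 + 1)"
      proof (rule tail_c)
        show "i * M \<le> s * M - 1" if "i < s" for i
          using mult_strict_right_mono[OF that, of M] M2 by linarith
        show "indep_connected (W s (s * M - 1) (s * M - 1)) E ((2 * int r + 1) * int s - 2)"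
          using Q[of s'] Suc \<open>s < t\<close> by simp
      qed
      moreover have e: "s * M - 1 + 3 = s * M + 2" using Suc M2 by simp
      ultimately show ?thesis unfolding e by simp
    qed
    from indep_connected_fold[OF M2 this] show ?thesis by simp
  qed
  show ?case
  proof (cases t)
    case 0
    then show ?thesis using indep_connected_minus_1[of "a 0"] by (simp add: W_def)
  next
    case (Suc s)
    then have s: "s < t" by simp
    let ?k = "(2 * int r + 1) * int (s + 1) - 1"
    have q: "indep_connected (W (s + 1) ((s + 1) * M - 1) ((s + 1) * M - 1)) E (?k - 1)"
      using Q[OF s] by (simp add: algebra_simps)
    have "indep_connected (W (s + 1) (s * M + 2 + 3 * r) (s * M + 2 + 3 * r)) E ((2 * int r + 1) * int s + 2 * int r)"
      by (rule tails[OF mono' mono']) (use F[OF s] in auto)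
    moreover have e: "s * M + 2 + 3 * r = (s + 1) * M" using M by simp
    ultimately have g: "indep_connected (W (s + 1) ((s + 1) * M) ((s + 1) * M)) E ?k" unfolding e
      by (simp add: algebra_simps)
    have e: "s * M + 3 * (r + 1) = (s + 1) * M + 1" using M by simp
    have "indep_connected (W (s + 1) (s * M + 3 * (r + 1)) (s * M + 3 * (r + 1))) E ((2 * int r + 1) * int s - 1 + 2 * int (r + 1))"
      by (rule tails[OF mono mono]) (use less[OF s] in auto)
    \<comment> \<open>This deletion is one degree better than required; the link is the
      bottleneck.\<close>
    then have "indep_connected (W (s + 1) ((s + 1) * M + 1) ((s + 1) * M + 1)) E ?k"
      unfolding e by (rule k_connected_mono) (simp add: algebra_simps)
    with g q show ?thesis
      using indep_connected_end[OF M2, of s "(s + 1) * M" ?k] indep_connected_end[OF M2, of s "(s + 1) * M + 1" ?k] Suc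
      by (simp add: add.commute)
  qed
qed

end

section \<open>Retraction onto a sphere\<close>

text \<open>A null-homotopy of \<alpha>, followed by \<beta>, would contract the sphere.\<close>

lemma not_k_connected_sphere_retract:
  assumes \<alpha>: "continuous_map (nsphere d) Y \<alpha>" and \<beta>: "continuous_map Y (nsphere d) \<beta>"
    and id: "\<And>x. x \<in> topspace (nsphere d) \<Longrightarrow> \<beta> (\<alpha> x) = x"
  shows "\<not> k_connected Y (int d)"
proof
  assume "k_connected Y (int d)"
  then obtain c where "homotopic_with (\<lambda>_. True) (nsphere d) Y \<alpha> (\<lambda>_. c)"
    using \<alpha> unfolding k_connected_def by blast
  from homotopic_with_compose_continuous_map_left[OF this \<beta>, of "\<lambda>_. True"]
  have "homotopic_with (\<lambda>_. True) (nsphere d) (nsphere d) (\<beta> \<circ> \<alpha>) (\<beta> \<circ> (\<lambda>_. c))" by simp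
  then have "homotopic_with (\<lambda>_. True) (nsphere d) (nsphere d) id (\<lambda>_. \<beta> c)"
    by (rule homotopic_with_eq) (use id in auto)
  then show False using non_contractible_space_nsphere unfolding contractible_space_def by blast
qed

text \<open>The edges between \<open>u\<close> and \<open>leaf u\<close>, for \<open>u \<in> D\<close>, form an induced matching, so they span a
  cross-polytope in the independence complex (\<open>\<alpha>\<close>). The stars partition \<open>V\<close>, and an independent set
  cannot contain both the center of a star and another vertex of it; collapsing every star to its edge
  therefore gives a retraction (\<open>\<beta>\<close>).\<close>

lemma indep_not_connected_perfect_code:
  fixes V :: "'v set"
  assumes V: "finite V" and D: "D \<subseteq> V" "card D = Suc d"
    and cen: "\<And>u. u \<in> V \<Longrightarrow> cen u \<in> D" "\<And>u. u \<in> D \<Longrightarrow> cen u = u"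
    and star: "\<And>u. u \<in> V \<Longrightarrow> cen u \<noteq> u \<Longrightarrow> E u (cen u)"
    and leaf: "\<And>u. u \<in> D \<Longrightarrow> leaf u \<in> V \<and> cen (leaf u) = u \<and> leaf u \<noteq> u"
    and irrefl: "\<And>u. \<not> E u u"
    and matching: "\<And>u w x y. \<lbrakk>u \<in> D; w \<in> D; u \<noteq> w; x \<in> {u, leaf u}; y \<in> {w, leaf w}\<rbrakk> \<Longrightarrow> \<not> E x y"
  shows "\<not> indep_connected V E (int d)"
proof -
  have finD: "finite D" using V D finite_subset by blast
  obtain e where e: "bij_betw e {..<Suc d} D"
    using ex_bij_betw_nat_finite[OF finD] D(2) by (auto simp: lessThan_atLeast0)
  define e' where "e' = the_inv_into {..<Suc d} e"
  have ee: "e' (e i) = i" "e i \<in> D" if "i < Suc d" for i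
    using that e by (auto simp: e'_def bij_betw_def the_inv_into_f_f)
  have e'bij: "bij_betw e' D {..<Suc d}" unfolding e'_def by (rule bij_betw_the_inv_into[OF e])
  have ee': "e (e' u) = u" "e' u < Suc d" if "u \<in> D" for u
    using that e bij_betw_apply[OF e'bij that] by (auto simp: e'_def bij_betw_def f_the_inv_into_f)
  let ?K = "indep_complex V E"
  have leafD: "leaf u \<notin> D" if "u \<in> D" for u using leaf[OF that] cen(2) by metis
  define s where "s x = (\<Sum>i<Suc d. \<bar>x i\<bar>)" for x :: "nat \<Rightarrow> real"
  \<comment> \<open>The sign of a coordinate chooses between a center and its leaf; dividing by the
    sum of absolute values gives barycentric coordinates.\<close>
  define \<alpha> where "\<alpha> x = (\<lambda>u. if u \<in> D then max (x (e' u)) 0 / s x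
      else if u \<in> leaf ` D then max (- x (e' (cen u))) 0 / s x else 0)" for x
  \<comment> \<open>On an independent support one of the two terms vanishes in each star. So nothing
    cancels, and \<delta> has a nonzero entry at every point of the realization.\<close>
  define \<delta> where "\<delta> w i = (if i < Suc d then w (e i) - (\<Sum>u\<in>{u \<in> V. cen u = e i \<and> u \<noteq> e i}. w u) else 0)"
    for w :: "'v \<Rightarrow> real" and i
  define \<beta> where "\<beta> w = (\<lambda>i. \<delta> w i / l2 (Suc d) (\<delta> w))" for w
  have s0: "0 < s x" if "x \<in> topspace (nsphere d)" for x
  proof -
    have "0 < l2 (Suc d) x" using that by (simp add: topspace_nsphere)
    then obtain i where i: "i < Suc d" "x i \<noteq> 0" using l2_pos_iff by blast
    then have "0 < \<bar>x i\<bar>" by simp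
    also have "\<bar>x i\<bar> \<le> s x" unfolding s_def by (rule member_le_sum) (use i in auto)
    finally show ?thesis .
  qed
  have cx: "continuous_on S (\<lambda>x. x i)" for S :: "('b \<Rightarrow> real) set" and i
    by (rule continuous_on_subset[OF continuous_on_product_coordinates subset_UNIV])
  have c\<alpha>: "continuous_on (topspace (nsphere d)) \<alpha>"
  proof (rule continuous_on_coordinatewise_then_product)
    fix u
    have "continuous_on (topspace (nsphere d)) s" unfolding s_def by (intro continuous_on_sum continuous_on_rabs cx)
    then show "continuous_on (topspace (nsphere d)) (\<lambda>x. \<alpha> x u)"
      unfolding \<alpha>_def using s0
      by (cases "u \<in> D"; cases "u \<in> leaf ` D")
         (auto intro!: continuous_on_divide continuous_on_max continuous_on_minus cx continuous_on_const simp: less_le)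
  qed
  have \<alpha>K: "\<alpha> x \<in> realiz ?K" if x: "x \<in> topspace (nsphere d)" for x
  proof (rule realizI[where T = "D \<union> leaf ` D"])
    have sx: "0 < s x" by (rule s0[OF x])
    show "0 \<le> \<alpha> x u" for u using sx by (simp add: \<alpha>_def)
    show sub: "{u. \<alpha> x u \<noteq> 0} \<subseteq> D \<union> leaf ` D" by (auto simp: \<alpha>_def)
    show "finite (D \<union> leaf ` D)" using finD by simp
    have sgn: "(if u \<in> D then x (e' (cen u)) > 0 else x (e' (cen u)) < 0) \<and> cen u \<in> D \<and> u \<in> {cen u, leaf (cen u)}" if au: "\<alpha> x u \<noteq> 0" for u
    proof (cases "u \<in> D")
      case True
      then show ?thesis using au sx cen by (auto simp: \<alpha>_def max_def split: if_splits)
    next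
      case False
      then obtain w where "w \<in> D" "u = leaf w" using au by (auto simp: \<alpha>_def split: if_splits)
      then show ?thesis using au sx leaf[of w] False by (auto simp: \<alpha>_def max_def split: if_splits)
    qed
    show "{u. \<alpha> x u \<noteq> 0} \<in> ?K"
      unfolding indep_complex_def
    proof (intro CollectI conjI ballI)
      show "{u. \<alpha> x u \<noteq> 0} \<subseteq> V" using sub D(1) leaf by blast
      fix u w assume "u \<in> {u. \<alpha> x u \<noteq> 0}" "w \<in> {u. \<alpha> x u \<noteq> 0}"
      then have u: "\<alpha> x u \<noteq> 0" and w: "\<alpha> x w \<noteq> 0" by auto
      show "\<not> E u w"
      proof (cases "cen u = cen w")
        case True
        then have "u \<in> D \<longleftrightarrow> w \<in> D" using sgn[OF u] sgn[OF w] by (auto split: if_splits)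
        moreover have "u = (if u \<in> D then cen u else leaf (cen u))" "w = (if w \<in> D then cen w else leaf (cen w))" 
          using sgn[OF u] sgn[OF w] cen(2)[of u] cen(2)[of w] by auto
        ultimately have "u = w" using True by metis
        then show ?thesis using irrefl by simp
      next
        case False
        then show ?thesis using matching[of "cen u" "cen w" u w] sgn[OF u] sgn[OF w] by blast
      qed
    qed
    have "sum (\<alpha> x) (D \<union> leaf ` D) = sum (\<alpha> x) D + sum (\<alpha> x) (leaf ` D)"
      by (rule sum.union_disjoint) (use finD leafD in auto)
    also have "sum (\<alpha> x) (leaf ` D) = (\<Sum>u\<in>D. \<alpha> x (leaf u))"
      by (subst sum.reindex) (auto intro!: inj_onI dest: leaf, metis leaf)
    also have "sum (\<alpha> x) D + (\<Sum>u\<in>D. \<alpha> x (leaf u)) = (\<Sum>u\<in>D. \<bar>x (e' u)\<bar> / s x)"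
      unfolding sum.distrib[symmetric]
      by (intro sum.cong refl) (use leafD leaf in \<open>auto simp: \<alpha>_def max_def divide_simps\<close>)
    also have "\<dots> = (\<Sum>i<Suc d. \<bar>x i\<bar> / s x)"
      by (rule sum.reindex_bij_betw[OF e'bij, of "\<lambda>i. \<bar>x i\<bar> / s x"])
    also have "\<dots> = 1" using sx unfolding sum_divide_distrib[symmetric] s_def[symmetric] by simp
    finally show "sum (\<alpha> x) (D \<union> leaf ` D) = 1" .
  qed
  have \<delta>0: "0 < l2 (Suc d) (\<delta> w)" if w: "w \<in> realiz ?K" for w
  proof (rule ccontr)
    assume "\<not> 0 < l2 (Suc d) (\<delta> w)"
    then have z: "\<delta> w i = 0" if "i < Suc d" for i using l2_pos_iff that by blast
    note w0 = realizD(1)[OF w]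
    have supp: "{u. w u \<noteq> 0} \<in> ?K" using realizD(2)[OF w] .
    have zero: "w u = 0" if u: "u \<in> V" for u
    proof -
      let ?T = "{y \<in> V. cen y = cen u \<and> y \<noteq> cen u}"
      have c: "cen u \<in> D" by (rule cen(1)[OF u])
      have eq: "w (cen u) = sum w ?T" using z[OF ee'(2)[OF c]] ee'[OF c] by (simp add: \<delta>_def)
      have cz: "w (cen u) = 0"
      proof (rule ccontr)
        assume n: "w (cen u) \<noteq> 0"
        have "w y = 0" if "y \<in> ?T" for y
        proof (rule ccontr)
          assume "w y \<noteq> 0"
          then have "\<not> E y (cen y)" using supp n that by (auto simp: indep_complex_def)
          then show False using star[of y] that by auto
        qed
        then show False using eq n by simp
      qed
      then have "sum w ?T = 0" using eq by simp
      then have "\<forall>y\<in>?T. w y = 0" using V w0 by (subst (asm) sum_nonneg_eq_0_iff) auto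
      then show ?thesis using cz u by (cases "u = cen u") auto
    qed
    have "sum w V = 1" by (rule realiz_sum[OF w V]) (use supp in \<open>auto simp: indep_complex_def\<close>)
    then show False using zero by simp
  qed
  have c\<delta>: "continuous_on S (\<lambda>w. \<delta> w i)" for S i
    by (cases "i < Suc d") (simp_all add: \<delta>_def continuous_on_diff continuous_on_sum cx del: less_Suc_eq)
  have c\<beta>: "continuous_on (realiz ?K) \<beta>"
  proof (rule continuous_on_coordinatewise_then_product)
    fix i
    have "continuous_on (realiz ?K) (\<lambda>w. l2 (Suc d) (\<delta> w))"
      unfolding l2_def by (intro continuous_on_real_sqrt continuous_on_sum continuous_on_power c\<delta>)
    then show "continuous_on (realiz ?K) (\<lambda>w. \<beta> w i)"
      unfolding \<beta>_def by (rule continuous_on_divide[OF c\<delta>]) (use \<delta>0 in force)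
  qed
  have \<beta>S: "\<beta> w \<in> topspace (nsphere d)" if "w \<in> realiz ?K" for w
  proof -
    have "l2 (Suc d) (\<beta> w) = 1"
      unfolding \<beta>_def using l2_scale[of "1 / l2 (Suc d) (\<delta> w)" "Suc d" "\<delta> w"] \<delta>0[OF that] by simp
    moreover have "\<beta> w j = 0" if "Suc d \<le> j" for j using that by (simp add: \<beta>_def \<delta>_def)
    ultimately show ?thesis by (simp add: topspace_nsphere)
  qed
  have \<beta>\<alpha>: "\<beta> (\<alpha> x) = x" if x: "x \<in> topspace (nsphere d)" for x
  proof -
    have sx: "0 < s x" by (rule s0[OF x])
    have "\<delta> (\<alpha> x) i = (1 / s x) * x i" for i
    proof (cases "i < Suc d")
      case True
      let ?c = "e i" and ?T = "{u \<in> V. cen u = e i \<and> u \<noteq> e i}"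
      have c: "?c \<in> D" using ee True by simp
      have "sum (\<alpha> x) ?T = sum (\<alpha> x) {leaf ?c}"
      proof (rule sum.mono_neutral_right)
        show "\<forall>u\<in>?T - {leaf ?c}. \<alpha> x u = 0"
        proof
          fix u assume u: "u \<in> ?T - {leaf ?c}"
          have "u \<notin> D" using cen(2)[of u] u by auto
          moreover have "u \<notin> leaf ` D" using leaf u by auto
          ultimately show "\<alpha> x u = 0" by (simp add: \<alpha>_def)
        qed
      qed (use V leaf[OF c] in auto)
      then have "\<delta> (\<alpha> x) i = \<alpha> x ?c - \<alpha> x (leaf ?c)" using True by (simp add: \<delta>_def)
      also have "\<dots> = max (x i) 0 / s x - max (- x i) 0 / s x"
        using c leafD[OF c] leaf[OF c] ee(1)[OF True] by (simp add: \<alpha>_def)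
      also have "\<dots> = (1 / s x) * x i" by (simp add: max_def)
      finally show ?thesis .
    next
      case False
      then show ?thesis using x by (simp add: \<delta>_def topspace_nsphere)
    qed
    then have "\<delta> (\<alpha> x) = (\<lambda>i. (1 / s x) * x i)" by auto
    moreover have "l2 (Suc d) (\<lambda>i. (1 / s x) * x i) = 1 / s x"
      using l2_scale[of "1 / s x" "Suc d" x] sx x by (simp add: topspace_nsphere)
    ultimately show ?thesis using sx by (simp add: \<beta>_def)
  qed
  show ?thesis unfolding geom_real_eq
  proof (rule not_k_connected_sphere_retract[where \<alpha> = \<alpha> and \<beta> = \<beta>])
    show "continuous_map (nsphere d) (top_of_set (realiz ?K)) \<alpha>"
      by (subst nsphere_top_of_set) (use c\<alpha> \<alpha>K in auto)
    show "continuous_map (top_of_set (realiz ?K)) (nsphere d) \<beta>"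
      by (subst nsphere_top_of_set) (use c\<beta> \<beta>S in auto)
  qed (rule \<beta>\<alpha>)
qed

section \<open>The graphs of the theorem\<close>

text \<open>The range conditions of \<open>G_edge0\<close> depend on \<open>t\<close>. They hold
  automatically on the vertex sets and are dropped, so that one relation serves all graphs of the
  recursion.\<close>

fun ladder_arc :: "nat \<Rightarrow> vtx \<Rightarrow> vtx \<Rightarrow> bool" where
  "ladder_arc n (B i j) (B i' j') \<longleftrightarrow> i' = i \<and> j' = Suc j \<or> j = n - 1 \<and> i' = Suc i \<and> j' = 1"
| "ladder_arc n (C i j) (C i' j') \<longleftrightarrow> i' = i \<and> j' = Suc j \<or> j = n - 1 \<and> i' = Suc i \<and> j' = 1"
| "ladder_arc n (A i) (B i' j) \<longleftrightarrow> j = 1 \<and> i' = Suc i \<or> j = n - 1 \<and> i' = i"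
| "ladder_arc n (A i) (C i' j) \<longleftrightarrow> j = 1 \<and> i' = Suc i \<or> j = n - 1 \<and> i' = i"
| "ladder_arc n _ _ \<longleftrightarrow> False"

definition ladder_adj :: "nat \<Rightarrow> vtx \<Rightarrow> vtx \<Rightarrow> bool" where
  "ladder_adj n u v \<longleftrightarrow> ladder_arc n u v \<or> ladder_arc n v u"

lemma G_edge0_iff:
  assumes n: "3 \<le> n" and uv: "u \<in> G_verts n t" "v \<in> G_verts n t"
  shows "G_edge0 n t u v \<longleftrightarrow> ladder_arc n u v"
proof (cases u)
  case u: (A i)
  then show ?thesis using uv by (cases v) (auto simp: G_edge0_def G_verts_def)
next
  case u: (B i j)
  then show ?thesis using uv n by (cases v) (auto simp: G_edge0_def G_verts_def)
next
  case u: (C i j)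
  then show ?thesis using uv n by (cases v) (auto simp: G_edge0_def G_verts_def)
qed

lemma indep_complex_G:
  assumes "3 \<le> n"
  shows "indep_complex (G_verts n t) (G_adj n t) = indep_complex (G_verts n t) (ladder_adj n)"
  by (rule indep_complex_cong) (simp add: G_adj_def ladder_adj_def G_edge0_iff[OF assms])

lemma indep_complex_H:
  assumes "3 \<le> n"
  shows "indep_complex (H_verts n t) (H_adj n t) = indep_complex (H_verts n t) (ladder_adj n)"
proof (rule indep_complex_cong)
  have "H_verts n t \<subseteq> G_verts n (t + 1)" using assms by (auto simp: H_verts_def G_verts_def)
  then show "H_adj n t u v \<longleftrightarrow> ladder_adj n u v" if "u \<in> H_verts n t" "v \<in> H_verts n t" for u v
    using that by (auto simp: H_adj_def G_adj_def ladder_adj_def G_edge0_iff[OF assms] subset_iff)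
qed

text \<open>The blocks of a row laid end to end: positions are counted from 0, blocks and places
  within them from 1.\<close>

definition rail :: "(nat \<Rightarrow> nat \<Rightarrow> vtx) \<Rightarrow> nat \<Rightarrow> nat \<Rightarrow> vtx" where
  "rail f M p = f (Suc (p div M)) (Suc (p mod M))"

lemma rail_image:
  assumes "0 < M"
  shows "rail f M ` {..<t * M} = {f i j | i j. 1 \<le> i \<and> i \<le> t \<and> 1 \<le> j \<and> j \<le> M}"
proof (intro equalityI subsetI)
  fix u assume "u \<in> rail f M ` {..<t * M}"
  then obtain p where p: "p < t * M" "u = rail f M p" by auto
  then have "p div M < t" "p mod M < M" using assms by (auto simp: less_mult_imp_div_less)
  then show "u \<in> {f i j | i j. 1 \<le> i \<and> i \<le> t \<and> 1 \<le> j \<and> j \<le> M}"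
    using p(2) by (force simp: rail_def Suc_le_eq)
next
  fix u assume "u \<in> {f i j | i j. 1 \<le> i \<and> i \<le> t \<and> 1 \<le> j \<and> j \<le> M}"
  then obtain i j where u: "u = f (Suc i) (Suc j)" "i < t" "j < M"
    by (auto simp: Suc_le_eq) (metis Suc_le_eq Suc_pred less_eq_Suc_le One_nat_def)
  have "i * M + j < Suc i * M" using u by simp
  also have "\<dots> \<le> t * M" using u by (intro mult_le_mono1) simp
  finally have "i * M + j \<in> {..<t * M}" by simp
  moreover have "rail f M (i * M + j) = u" using u by (simp add: rail_def)
  ultimately show "u \<in> rail f M ` {..<t * M}" by blast
qed

lemma div_mod_eq_iff: "p div M = q div M \<and> p mod M = q mod M \<longleftrightarrow> p = (q::nat)"
  by (metis div_mult_mod_eq)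

text \<open>Successor in base \<open>M\<close>, without and with carry: an edge inside a block, or
  the edge joining two blocks.\<close>

lemma div_mod_Suc_iff:
  assumes "0 < M"
  shows "q div M = p div M \<and> q mod M = Suc (p mod M) \<or> Suc (p mod M) = M \<and> q div M = Suc (p div M) \<and> q mod M = 0
     \<longleftrightarrow> q = Suc (p::nat)"
proof
  assume "q = Suc p"
  then show "q div M = p div M \<and> q mod M = Suc (p mod M) \<or> Suc (p mod M) = M \<and> q div M = Suc (p div M) \<and> q mod M = 0"
    by (simp add: mod_Suc div_Suc) 
next
  assume "q div M = p div M \<and> q mod M = Suc (p mod M) \<or> Suc (p mod M) = M \<and> q div M = Suc (p div M) \<and> q mod M = 0"
  then show "q = Suc p"
  proof
    assume "q div M = p div M \<and> q mod M = Suc (p mod M)"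
    then have "q div M * M + q mod M = p div M * M + Suc (p mod M)" by (simp only:)
    then show ?thesis by simp
  next
    assume h: "Suc (p mod M) = M \<and> q div M = Suc (p div M) \<and> q mod M = 0"
    then have "q div M * M + q mod M = p div M * M + M" by (simp only: mult_Suc)
    also have "\<dots> = p div M * M + Suc (p mod M)" using h by simp
    finally show ?thesis by simp
  qed
qed

text \<open>With blocks counted from 0, rung \<open>i\<close> meets the first place of block
  \<open>i\<close> and the last place of the block before.\<close>

lemma div_mod_mult_iff:
  assumes "0 < (M::nat)"
  shows "p mod M = 0 \<and> p div M = i \<or> Suc (p mod M) = M \<and> Suc (p div M) = i \<longleftrightarrow> p = i * M \<or> Suc p = i * M"
proof
  assume "p mod M = 0 \<and> p div M = i \<or> Suc (p mod M) = M \<and> Suc (p div M) = i"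
  then show "p = i * M \<or> Suc p = i * M"
  proof
    assume "p mod M = 0 \<and> p div M = i"
    then show ?thesis by auto
  next
    assume h: "Suc (p mod M) = M \<and> Suc (p div M) = i"
    have "Suc p = p div M * M + Suc (p mod M)" by simp
    also have "\<dots> = i * M" using h by auto
    finally show ?thesis by simp
  qed
next
  assume "p = i * M \<or> Suc p = i * M"
  then show "p mod M = 0 \<and> p div M = i \<or> Suc (p mod M) = M \<and> Suc (p div M) = i"
  proof
    assume "Suc p = i * M"
    then have "Suc p mod M = 0" "Suc p div M = i" using assms by auto
    then show ?thesis by (auto simp: mod_Suc div_Suc split: if_splits)
  qed (use assms in simp)
qed

lemma ladder_vtx:
  assumes "3 \<le> n"
  shows "ladder (ladder_adj n) A (rail B (n - 1)) (rail C (n - 1)) (n - 1)"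
proof
  define M where "M = n - 1"
  have M: "2 \<le> M" "0 < M" using assms by (auto simp: M_def)
  note defs = rail_def ladder_adj_def M_def[symmetric] 
  have S: "ladder_arc n (f (Suc i) (Suc j)) (f (Suc i') (Suc j')) \<longleftrightarrow> i' = i \<and> j' = Suc j \<or> Suc j = M \<and> i' = Suc i \<and> j' = 0"
    if "f = B \<or> f = C" for f i j i' j' using that by (auto simp: M_def)
  have T: "ladder_arc n (A i) (f (Suc i') (Suc j)) \<longleftrightarrow> j = 0 \<and> i' = i \<or> Suc j = M \<and> Suc i' = i"
    "\<not> ladder_arc n (f (Suc i') (Suc j)) (A i)"
    if "f = B \<or> f = C" for f i j i' using that by (auto simp: M_def)
  fix i j
  show "(rail B (n - 1) i = rail B (n - 1) j) = (i = j)" "(rail C (n - 1) i = rail C (n - 1) j) = (i = j)"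
    using div_mod_eq_iff[of i "n - 1" j] by (auto simp: rail_def)
  have R: "(ladder_arc n (f (Suc (i div M)) (Suc (i mod M))) (f (Suc (j div M)) (Suc (j mod M))) \<longleftrightarrow> j = Suc i)" 
    if "f = B \<or> f = C" for f i j unfolding S[OF that] using div_mod_Suc_iff[OF M(2)] by simp
  show "ladder_adj n (rail B (n - 1) i) (rail B (n - 1) j) \<longleftrightarrow> j = Suc i \<or> i = Suc j"
    "ladder_adj n (rail C (n - 1) i) (rail C (n - 1) j) \<longleftrightarrow> j = Suc i \<or> i = Suc j"
    unfolding defs by (simp_all only: R simp_thms)
  show "ladder_adj n (A i) (rail B (n - 1) j) \<longleftrightarrow> j = i * (n - 1) \<or> Suc j = i * (n - 1)"
    "ladder_adj n (A i) (rail C (n - 1) j) \<longleftrightarrow> j = i * (n - 1) \<or> Suc j = i * (n - 1)"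
    unfolding defs using div_mod_mult_iff[OF M(2), of j i] by (simp_all only: T simp_thms)
qed (auto simp: ladder_adj_def rail_def)

lemma indep_connected_GH:
  assumes n: "n = 3 * r + 3"
  shows "indep_connected (G_verts n t) (ladder_adj n) ((2 * int r + 1) * int t - 1)"
    and "indep_connected (H_verts n t) (ladder_adj n) ((2 * int r + 1) * int t - 1)"
proof -
  interpret ladder "ladder_adj n" A "rail B (n - 1)" "rail C (n - 1)" "n - 1"
    by (rule ladder_vtx) (use n in simp)
  have M: "0 < n - 1" using n by simp
  have "{A i | i. i \<le> t} = A ` {..<t + 1}" by auto
  then have G: "G_verts n t = W (t + 1) (t * (n - 1)) (t * (n - 1))"
    unfolding G_verts_def W_def rail_image[OF M] by simp
  have "rail B (n - 1) (t * (n - 1)) = B (t + 1) 1" "rail C (n - 1) (t * (n - 1)) = C (t + 1) 1"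
    using M by (simp_all add: rail_def)
  then have H: "H_verts n t = W (t + 1) (t * (n - 1) + 1) (t * (n - 1) + 1)"
    unfolding H_verts_def G W_def by (auto simp: lessThan_Suc)
  show "indep_connected (G_verts n t) (ladder_adj n) ((2 * int r + 1) * int t - 1)"
    "indep_connected (H_verts n t) (ladder_adj n) ((2 * int r + 1) * int t - 1)"
    using ladder_connected[of r t] n unfolding G H by simp_all
qed

section \<open>The perfect code and its induced matching\<close>

text \<open>For n = 3r + 3 the two ends of a row belong to the rungs beside them, and the 3r places
  between fall into triples around the multiples of 3; \<open>3 * ((j + 1) div 3)\<close> is the
  nearest multiple. Divisibility by 3 makes the stars fit exactly.\<close>

fun center :: "nat \<Rightarrow> vtx \<Rightarrow> vtx" where
  "center n (A i) = A i"
| "center n (B i j) = (if j = 1 then A (i - 1) else if j = n - 1 then A i else B i (3 * ((j + 1) div 3)))"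
| "center n (C i j) = (if j = 1 then A (i - 1) else if j = n - 1 then A i else C i (3 * ((j + 1) div 3)))"

fun leaf :: "nat \<Rightarrow> nat \<Rightarrow> vtx \<Rightarrow> vtx" where
  "leaf n t (A i) = (if i < t then B (i + 1) 1 else C t (n - 1))"
| "leaf n t (B i j) = B i (j + 1)"
| "leaf n t (C i j) = C i (j - 1)"

definition perfect_code :: "nat \<Rightarrow> nat \<Rightarrow> vtx set" where
  "perfect_code r t = {A i | i. i \<le> t} \<union> {B i (3 * k) | i k. 1 \<le> i \<and> i \<le> t \<and> 1 \<le> k \<and> k \<le> r}
     \<union> {C i (3 * k) | i k. 1 \<le> i \<and> i \<le> t \<and> 1 \<le> k \<and> k \<le> r}"

lemma card_perfect_code: "card (perfect_code r t) = Suc ((2 * r + 1) * t)"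
proof -
  have im: "{f i (3 * k) | i k. 1 \<le> i \<and> i \<le> t \<and> 1 \<le> k \<and> k \<le> r} = (\<lambda>(i, k). f i (3 * k)) ` ({1..t} \<times> {1..r})"
    for f :: "nat \<Rightarrow> nat \<Rightarrow> vtx" by (auto; blast)
  have B: "card ((\<lambda>(i, k). B i (3 * k)) ` ({1..t} \<times> {1..r})) = t * r"
    by (subst card_image) (auto simp: inj_on_def)
  have C: "card ((\<lambda>(i, k). C i (3 * k)) ` ({1..t} \<times> {1..r})) = t * r"
    by (subst card_image) (auto simp: inj_on_def)
  have A: "{A i | i. i \<le> t} = A ` {..t}" by auto
  have cA: "card (A ` {..t}) = t + 1" by (subst card_image) (auto simp: inj_on_def)
  have "card (perfect_code r t) = (t + 1) + t * r + t * r"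
    unfolding perfect_code_def im A
    by (subst card_Un_disjoint, simp, simp, force, subst card_Un_disjoint, simp, simp, force) (simp only: cA B C)
  then show ?thesis by (simp add: algebra_simps)
qed

text \<open>The two additional vertices of \<open>H_verts n t\<close> are adjacent to
  \<open>A t\<close> and join its star, so the same code and matching serve both graphs. The
  assumption on \<open>t\<close> provides the vertex \<open>C t (n - 1)\<close>.\<close>

lemma indep_not_connected_GH:
  assumes n: "n = 3 * r + 3" and t: "1 \<le> t" and V: "G_verts n t \<subseteq> V" "V \<subseteq> H_verts n t"
  shows "\<not> indep_connected V (ladder_adj n) (int ((2 * r + 1) * t))"
proof (rule indep_not_connected_perfect_code[where D = "perfect_code r t" and cen = "center n" and leaf = "leaf n t"])
  have vtx: "(\<exists>i\<le>t. u = A i) \<or> (\<exists>i j. (u = B i j \<or> u = C i j) \<and> 1 \<le> i \<and> (i \<le> t \<and> 1 \<le> j \<and> j \<le> 3 * r + 2 \<or> i = t + 1 \<and> j = 1))"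
    if "u \<in> V" for u
    using that V(2) n by (auto simp: H_verts_def G_verts_def)
  have "finite (G_verts n t)"
  proof -
    have M: "0 < n - 1" using n by simp
    show ?thesis unfolding G_verts_def rail_image[OF M, symmetric] by simp
  qed
  then have "finite (H_verts n t)" by (simp add: H_verts_def)
  then show "finite V" using V(2) finite_subset by blast
  show "perfect_code r t \<subseteq> V" using V(1) n by (force simp: perfect_code_def G_verts_def)
  show "card (perfect_code r t) = Suc ((2 * r + 1) * t)" by (rule card_perfect_code)
  have q': "\<exists>k. 3 * ((j + 1) div 3) = 3 * k \<and> 1 \<le> k \<and> k \<le> r \<and> (j = 3 * k \<or> j + 1 = 3 * k \<or> j = 3 * k + 1)"
    if "1 \<le> j" "j \<le> 3 * r + 2" "j \<noteq> 1" "j \<noteq> 3 * r + 2" for j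
    by (rule exI[of _ "(j + 1) div 3"]) (use that in presburger)
  show "center n u \<in> perfect_code r t" if "u \<in> V" for u
    using vtx[OF that] q' n by (fastforce simp: perfect_code_def)
  show "ladder_adj n u (center n u)" if "u \<in> V" "center n u \<noteq> u" for u
    using vtx[OF that(1)] q' that(2) n by (fastforce simp: ladder_adj_def)
  show "center n u = u" if "u \<in> perfect_code r t" for u
    using that n by (auto simp: perfect_code_def)
  show "leaf n t u \<in> V \<and> center n (leaf n t u) = u \<and> leaf n t u \<noteq> u" if "u \<in> perfect_code r t" for u
  proof -
    have "leaf n t u \<in> G_verts n t"
      using that n t by (auto simp: perfect_code_def G_verts_def) force
    moreover have "(3 * k + 2) div 3 = k" for k :: nat by simp
    ultimately show ?thesis using that n t V(1) by (auto simp: perfect_code_def split: if_splits)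
  qed
  show "\<not> ladder_adj n u u" for u by (cases u) (auto simp: ladder_adj_def)
  show "\<not> ladder_adj n x y" if "u \<in> perfect_code r t" "w \<in> perfect_code r t" "u \<noteq> w" "x \<in> {u, leaf n t u}" "y \<in> {w, leaf n t w}" for u w x y
    using that n by (auto simp: perfect_code_def ladder_adj_def split: if_splits) presburger+
qed

theorem theorem3p16:
  fixes m t n :: nat
  assumes "m \<ge> 1" and "n = 3 * m" and "t \<ge> 1"
  shows "connectivity_eq (geom_real (indep_complex (G_verts n t) (G_adj n t)))
           ((2 * int m - 1) * int t - 1)
       \<and> connectivity_eq (geom_real (indep_complex (H_verts n t) (H_adj n t)))
           ((2 * int m - 1) * int t - 1)"
proof -
  obtain r where r: "m = Suc r" using assms(1) by (cases m) auto
  have n: "n = 3 * r + 3" and n3: "3 \<le> n" using assms(2) r by auto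
  have k: "(2 * int m - 1) * int t - 1 = (2 * int r + 1) * int t - 1"
    "(2 * int r + 1) * int t - 1 + 1 = int ((2 * r + 1) * t)" using r by (auto simp: algebra_simps)
  have GH: "G_verts n t \<subseteq> H_verts n t" by (auto simp: H_verts_def)
  show ?thesis
    unfolding connectivity_eq_def indep_complex_G[OF n3] indep_complex_H[OF n3] k
    using indep_connected_GH[OF n] indep_not_connected_GH[OF n assms(3) _ GH] indep_not_connected_GH[OF n assms(3) GH] by blast
qed

end
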